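(* 1. $\mathcal{M}^!$ is the free $\mathcal{BG}^!$-algebra generated by $\bullet$. 2. For all $n\ge1$, $\dim\mathcal{BG}^!(n)=\dfrac{n\,(n+1)!}{2}$. 3. For all $n\ge 1$, $\mathcal{BG}^!(n)$ is freely generated, as an $S_n$-module, by the $\frac{n(n+1)}{2}$ left combs indexed by the pairs $(l,k)$ with $1\le l\le k\le n$, where the $(l,k)$ comb is the left-bracketed composition $$(\cdots((\,(\cdots((w\succ x_l)\,m\,x_{l+1})\cdots)\,m\,x_k)\prec x_{k+1})\cdots)\prec x_n,\qquad w=(\cdots((x_1\,m\,x_2)\,m\,x_3)\cdots)\,m\,x_{l-1};$$ that is, the left comb with leaves $1,2,\dots,n$ from left to right in which the vertex attaching leaf $j$ (as its right input) is labelled $m$ for $2\le j\le l-1$, $\succ$ for $j=l$ (if $l\ge2$), $m$ for $l+1\le j\le k$, and $\prec$ for $k+1\le j\le n$ (if $l=1$ there is no vertex labelled $\succ$, and one starts with $x_1$).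
   Context: $\mathbb{K}$ is a commutative field of any characteristic. A $\mathcal{BG}^!$-algebra is a $\mathbb{K}$-vector space $A$ with linear maps $\ast\,(=m),\succ,\prec:A\otimes A\to A$ such that for all $x,y,z\in A$: $(x\ast y)\succ z=x\succ(y\succ z)$, $(x\succ y)\ast z=x\succ(y\ast z)$, $(x\prec y)\prec z=x\prec(y\ast z)$, $(x\ast y)\prec z=x\ast(y\prec z)$, $(x\succ y)\prec z=x\succ(y\prec z)$, $(x\ast y)\ast z=x\ast(y\ast z)$, and $(x\succ y)\succ z=(x\prec y)\succ z=(x\prec y)\ast z=x\prec(y\prec z)=x\prec(y\succ z)=x\ast(y\succ z)=0$. $\mathcal{BG}^!$ is the (symmetric) operad of these algebras, the Koszul dual of the operad $\mathcal{BG}$ of bigraft algebras (defined by the first six relations only). We consider planar rooted forests (finite ordered sequences of planar rooted trees) whose edges are decorated by $l$ or $r$; $1$ is the empty forest and $\bullet$ the tree with one vertex. For two such forests $F,G$, $B(F\otimes G)$ is the tree obtained by grafting the roots of the trees of $F$ followed by those of $G$ (in this left-to-right order) on a common new root, the edges from the new root to the roots of $F$ being decorated by $l$ and those to the roots of $G$ by $r$. Let $\mathbb{T}$ be the set consisting of $1$ and of the trees obtained inductively as $B(F_1\cdots F_p\otimes G_1\cdots G_q)$, $p,q\ge 0$, with all $F_i,G_j$ nonempty trees already in $\mathbb{T}$; $\mathbb{F}$ is the set of forests all of whose trees are in $\mathbb{T}$ (including $1$). $\mathcal{M}$ is the vector space with basis $\mathbb{F}\setminus\{1\}$, a $\mathcal{BG}$-algebra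 for concatenation and the operations defined, for $F=F_1\cdots F_n$, $G=G_1\cdots G_k$ in $\mathbb{F}\setminus\{1\}$ (the $F_i,G_j$ nonempty trees) with $F_1=B(F_1^1\otimes F_1^2)$, $G_k=B(G_k^1\otimes G_k^2)$, by $G\succ F=B(GF_1^1\otimes F_1^2)F_2\cdots F_n$ and $G\prec F=G_1\cdots G_{k-1}B(G_k^1\otimes G_k^2F)$. A corolla is a tree in which every vertex is at distance at most $1$ from the root. Let $\mathbb{F}^!\subseteq\mathbb{F}$ consist of $1$ and of the forests $F_1\cdots F_n\in\mathbb{F}$ ($F_i$ nonempty trees) such that all $F_i$ are corollas, only $F_1$ may contain an edge decorated by $l$, and only $F_n$ may contain an edge decorated by $r$. Let $\mathbb{G}=\mathbb{F}\setminus\mathbb{F}^!$. The span $\mathbb{K}[\mathbb{G}]$ is an ideal of the $\mathcal{BG}$-algebra $\mathcal{M}$, and $\mathcal{M}^!=\mathcal{M}/\mathbb{K}[\mathbb{G}]$ with the quotient operations, which is a $\mathcal{BG}^!$-algebra (with basis the classes of $\mathbb{F}^!\setminus\{1\}$). *)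

theory Defs
  imports Complex_Main "HOL-Library.Poly_Mapping" "HOL-Library.FuncSet"
    "HOL-Combinatorics.Permutations"
begin

section \<open>Vector spaces with a given basis\<close>

text \<open>
  The vector space with basis \<open>'x\<close> over the field \<open>'k\<close> is the type \<open>'x \<Rightarrow>\<^sub>0 'k\<close> of finitely
  supported functions; \<open>Poly_Mapping.single x 1\<close> is the basis vector \<open>x\<close>.
\<close>

definition pscale :: "'k::field \<Rightarrow> ('x \<Rightarrow>\<^sub>0 'k) \<Rightarrow> ('x \<Rightarrow>\<^sub>0 'k)" where
  "pscale c f = Poly_Mapping.map ((*) c) f"

definition basis_vec :: "'x \<Rightarrow> ('x \<Rightarrow>\<^sub>0 'k::field)" where
  "basis_vec x = Poly_Mapping.single x 1"

definition lin_ext :: "('x \<Rightarrow> ('y \<Rightarrow>\<^sub>0 'k::field)) \<Rightarrow> ('x \<Rightarrow>\<^sub>0 'k) \<Rightarrow> ('y \<Rightarrow>\<^sub>0 'k)" where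
  "lin_ext h f = (\<Sum>x\<in>Poly_Mapping.keys f. pscale (Poly_Mapping.lookup f x) (h x))"

definition bilin_ext ::
    "('x \<Rightarrow> 'y \<Rightarrow> 'z) \<Rightarrow> ('x \<Rightarrow>\<^sub>0 'k::field) \<Rightarrow> ('y \<Rightarrow>\<^sub>0 'k) \<Rightarrow> ('z \<Rightarrow>\<^sub>0 'k)" where
  "bilin_ext p f g = lin_ext (\<lambda>x. lin_ext (\<lambda>y. basis_vec (p x y)) g) f"

lemma lookup_pscale [simp]: "Poly_Mapping.lookup (pscale c f) x = c * Poly_Mapping.lookup f x"
  unfolding pscale_def by (transfer) (auto simp: when_def)

interpretation pv: vector_space pscale
  by unfold_locales (auto intro!: poly_mapping_eqI simp: lookup_add algebra_simps)

lemma keys_pscale: "Poly_Mapping.keys (pscale c f) \<subseteq> Poly_Mapping.keys f"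
  by (auto simp: in_keys_iff)

lemma lin_ext_superset:
  assumes "finite A" "Poly_Mapping.keys f \<subseteq> A"
  shows "lin_ext h f = (\<Sum>x\<in>A. pscale (Poly_Mapping.lookup f x) (h x))"
  unfolding lin_ext_def using assms
  by (intro sum.mono_neutral_left) (auto simp: in_keys_iff)

lemma lin_ext_add: "lin_ext h (f + g) = lin_ext h f + lin_ext h g"
proof -
  let ?A = "Poly_Mapping.keys f \<union> Poly_Mapping.keys g"
  have "Poly_Mapping.keys (f + g) \<subseteq> ?A" by (rule keys_add)
  then show ?thesis
    by (simp add: lin_ext_superset[of ?A] lookup_add pv.scale_left_distrib sum.distrib)
qed

lemma lin_ext_scale: "lin_ext h (pscale c f) = pscale c (lin_ext h f)"
  using keys_pscale[of c f]
  by (simp add: lin_ext_superset[of "Poly_Mapping.keys f"] pv.scale_sum_right)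

lemma linear_lin_ext: "Vector_Spaces.linear pscale pscale (lin_ext h)"
  by unfold_locales (auto simp: lin_ext_add lin_ext_scale)

lemma lin_ext_0 [simp]: "lin_ext h 0 = 0"
  by (simp add: lin_ext_def)

lemma lin_ext_diff: "lin_ext h (f - g) = lin_ext h f - lin_ext h g"
  by (metis add_diff_cancel_right' diff_add_cancel lin_ext_add)

lemma lin_ext_basis_vec [simp]: "lin_ext h (basis_vec x) = h x"
  by (simp add: lin_ext_def basis_vec_def)

lemma basis_vec_expand: "lin_ext basis_vec f = f"
proof (rule poly_mapping_eqI)
  fix k
  have "Poly_Mapping.lookup (lin_ext basis_vec f) k =
      (\<Sum>x\<in>Poly_Mapping.keys f. Poly_Mapping.lookup f x * Poly_Mapping.lookup (basis_vec x) k)"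
    by (simp add: lin_ext_def lookup_sum)
  also have "\<dots> = (\<Sum>x\<in>Poly_Mapping.keys f. if x = k then Poly_Mapping.lookup f x else 0)"
    by (intro sum.cong) (auto simp: basis_vec_def lookup_single when_def)
  also have "\<dots> = Poly_Mapping.lookup f k"
    by (simp add: in_keys_iff)
  finally show "Poly_Mapping.lookup (lin_ext basis_vec f) k = Poly_Mapping.lookup f k" .
qed

lemma keys_basis_vec [simp]: "Poly_Mapping.keys (basis_vec x :: 'x \<Rightarrow>\<^sub>0 'k::field) = {x}"
  by (simp add: basis_vec_def)

lemma keys_sum_subset:
  fixes p :: "'i \<Rightarrow> ('x \<Rightarrow>\<^sub>0 'k::field)"
  assumes "\<And>i. i \<in> I \<Longrightarrow> Poly_Mapping.keys (p i) \<subseteq> S"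
  shows "Poly_Mapping.keys (sum p I) \<subseteq> S"
proof
  fix k assume "k \<in> Poly_Mapping.keys (sum p I)"
  then have "(\<Sum>i\<in>I. Poly_Mapping.lookup (p i) k) \<noteq> 0" by (simp add: in_keys_iff lookup_sum)
  then obtain i where "i \<in> I" "Poly_Mapping.lookup (p i) k \<noteq> 0" by (meson sum.neutral)
  then have "k \<in> Poly_Mapping.keys (p i)" by (simp add: in_keys_iff)
  with assms[OF \<open>i \<in> I\<close>] show "k \<in> S" by (rule subsetD)
qed

lemma keys_lin_ext:
  assumes "\<And>x. x \<in> Poly_Mapping.keys f \<Longrightarrow> Poly_Mapping.keys (h x) \<subseteq> S"
  shows "Poly_Mapping.keys (lin_ext h f) \<subseteq> S"
  unfolding lin_ext_def
proof (rule keys_sum_subset)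
  fix x assume "x \<in> Poly_Mapping.keys f"
  from assms[OF this] show "Poly_Mapping.keys (pscale (Poly_Mapping.lookup f x) (h x)) \<subseteq> S"
    by (rule subset_trans[OF keys_pscale])
qed

lemma keys_bilin_ext:
  assumes "\<And>x y. x \<in> Poly_Mapping.keys f \<Longrightarrow> y \<in> Poly_Mapping.keys g \<Longrightarrow> p x y \<in> S"
  shows "Poly_Mapping.keys (bilin_ext p f g) \<subseteq> S"
  unfolding bilin_ext_def by (rule keys_lin_ext, rule keys_lin_ext) (simp add: assms)

lemma lin_ext_fun_diff: "lin_ext (\<lambda>x. h x - h' x) f = lin_ext h f - lin_ext h' f"
  by (simp add: lin_ext_def pv.scale_right_diff_distrib sum_subtractf)

lemma lin_ext_fun_add: "lin_ext (\<lambda>x. h x + h' x) f = lin_ext h f + lin_ext h' f"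
  by (simp add: lin_ext_def pv.scale_right_distrib sum.distrib)

lemma lin_ext_fun_scale: "lin_ext (\<lambda>x. pscale c (h x)) f = pscale c (lin_ext h f)"
  by (simp add: lin_ext_def pv.scale_sum_right mult.commute)

lemma bilin_ext_diff_left: "bilin_ext p (f - f') g = bilin_ext p f g - bilin_ext p f' g"
  by (simp add: bilin_ext_def lin_ext_diff)

lemma bilin_ext_diff_right: "bilin_ext p f (g - g') = bilin_ext p f g - bilin_ext p f g'"
  by (simp add: bilin_ext_def lin_ext_diff lin_ext_fun_diff)

lemma bilin_ext_add_left: "bilin_ext p (f + f') g = bilin_ext p f g + bilin_ext p f' g"
  by (simp add: bilin_ext_def lin_ext_add)

lemma bilin_ext_add_right: "bilin_ext p f (g + g') = bilin_ext p f g + bilin_ext p f g'"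
  by (simp add: bilin_ext_def lin_ext_add lin_ext_fun_add)

lemma bilin_ext_scale_left: "bilin_ext p (pscale c f) g = pscale c (bilin_ext p f g)"
  by (simp add: bilin_ext_def lin_ext_scale)

lemma bilin_ext_scale_right: "bilin_ext p f (pscale c g) = pscale c (bilin_ext p f g)"
  by (simp add: bilin_ext_def lin_ext_scale lin_ext_fun_scale)

lemma bilin_ext_basis_vec [simp]: "bilin_ext p (basis_vec x) (basis_vec y) = basis_vec (p x y)"
  by (simp add: bilin_ext_def)


section \<open>Algebras over the dual bigraft operad\<close>

locale bgdual_algebra = vector_space scale
  for scale :: "'k::field \<Rightarrow> 'a::ab_group_add \<Rightarrow> 'a" +
  fixes mul succ prec :: "'a \<Rightarrow> 'a \<Rightarrow> 'a"
  assumes mul_linear: "\<And>y. Vector_Spaces.linear scale scale (\<lambda>x. mul x y)"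
      "\<And>x. Vector_Spaces.linear scale scale (mul x)"
    and succ_linear: "\<And>y. Vector_Spaces.linear scale scale (\<lambda>x. succ x y)"
      "\<And>x. Vector_Spaces.linear scale scale (succ x)"
    and prec_linear: "\<And>y. Vector_Spaces.linear scale scale (\<lambda>x. prec x y)"
      "\<And>x. Vector_Spaces.linear scale scale (prec x)"
    and mul_succ: "\<And>x y z. succ (mul x y) z = succ x (succ y z)"
    and succ_mul: "\<And>x y z. mul (succ x y) z = succ x (mul y z)"
    and prec_prec: "\<And>x y z. prec (prec x y) z = prec x (mul y z)"
    and mul_prec: "\<And>x y z. prec (mul x y) z = mul x (prec y z)"
    and succ_prec: "\<And>x y z. prec (succ x y) z = succ x (prec y z)"
    and mul_mul: "\<And>x y z. mul (mul x y) z = mul x (mul y z)"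
    and succ_succ_0: "\<And>x y z. succ (succ x y) z = 0"
    and prec_succ_0: "\<And>x y z. succ (prec x y) z = 0"
    and prec_mul_0: "\<And>x y z. mul (prec x y) z = 0"
    and prec_prec_0: "\<And>x y z. prec x (prec y z) = 0"
    and prec_succ'_0: "\<And>x y z. prec x (succ y z) = 0"
    and mul_succ'_0: "\<And>x y z. mul x (succ y z) = 0"

locale bgdual_hom =
  dom: bgdual_algebra scale mul succ prec + cod: bgdual_algebra scale' mul' succ' prec' +
  Vector_Spaces.linear scale scale' \<phi>
  for scale :: "'k::field \<Rightarrow> 'a::ab_group_add \<Rightarrow> 'a" and mul succ prec :: "'a \<Rightarrow> 'a \<Rightarrow> 'a"
    and scale' :: "'k \<Rightarrow> 'b::ab_group_add \<Rightarrow> 'b" and mul' succ' prec' :: "'b \<Rightarrow> 'b \<Rightarrow> 'b"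
    and \<phi> :: "'a \<Rightarrow> 'b" +
  assumes hom_mul: "\<And>x y. \<phi> (mul x y) = mul' (\<phi> x) (\<phi> y)"
    and hom_succ: "\<And>x y. \<phi> (succ x y) = succ' (\<phi> x) (\<phi> y)"
    and hom_prec: "\<And>x y. \<phi> (prec x y) = prec' (\<phi> x) (\<phi> y)"


section \<open>The algebra of decorated forests and its quotient\<close>

text \<open>
  In a tree of \<open>\<T>\<close> the \<open>l\<close>-edges leaving a vertex all lie to the left of the \<open>r\<close>-edges leaving
  it, so the nonempty trees of \<open>\<T>\<close> are freely generated by \<open>B\<close>: in \<open>B F G\<close> the list \<open>F\<close>
  collects the subtrees attached to the root by an \<open>l\<close>-edge and \<open>G\<close> those attached by an
  \<open>r\<close>-edge, both from left to right. Forests are lists of such trees and the empty forest is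
  the empty list.
\<close>

datatype dtree = B "dtree list" "dtree list"

fun has_l_edge :: "dtree \<Rightarrow> bool" where
  "has_l_edge (B F G) \<longleftrightarrow> F \<noteq> [] \<or> (\<exists>T\<in>set F. has_l_edge T) \<or> (\<exists>T\<in>set G. has_l_edge T)"

fun has_r_edge :: "dtree \<Rightarrow> bool" where
  "has_r_edge (B F G) \<longleftrightarrow> G \<noteq> [] \<or> (\<exists>T\<in>set F. has_r_edge T) \<or> (\<exists>T\<in>set G. has_r_edge T)"

text \<open>The set of the distances to the root of the vertices of a tree.\<close>

fun root_dists :: "dtree \<Rightarrow> nat set" where
  "root_dists (B F G) = {0} \<union> (\<Union>T\<in>set F. Suc ` root_dists T) \<union> (\<Union>T\<in>set G. Suc ` root_dists T)"

definition corolla :: "dtree \<Rightarrow> bool" where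
  "corolla T \<longleftrightarrow> (\<forall>d\<in>root_dists T. d \<le> 1)"

typedef forest = "{F :: dtree list. F \<noteq> []}"
  morphisms trees_of Forest by blast

setup_lifting type_definition_forest

lift_definition bullet :: forest is "[B [] []]" by simp

lift_definition fcat :: "forest \<Rightarrow> forest \<Rightarrow> forest" is "(@)" by simp

fun succ_trees :: "dtree list \<Rightarrow> dtree list \<Rightarrow> dtree list" where
  "succ_trees G (B F1 F2 # Fs) = B (G @ F1) F2 # Fs"
| "succ_trees G [] = []"

fun prec_trees :: "dtree list \<Rightarrow> dtree list \<Rightarrow> dtree list" where
  "prec_trees [] F = []"
| "prec_trees [B G1 G2] F = [B G1 (G2 @ F)]"
| "prec_trees (T # T' # Ts) F = T # prec_trees (T' # Ts) F"

lift_definition fsucc :: "forest \<Rightarrow> forest \<Rightarrow> forest" is succ_trees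
  by (metis list.distinct(1) succ_trees.elims)

lemma prec_trees_snoc: "prec_trees (Ts @ [B G1 G2]) F = Ts @ [B G1 (G2 @ F)]"
proof (induction Ts)
  case (Cons T Ts) then show ?case by (cases "Ts @ [B G1 G2]") auto
qed simp

lemma prec_trees_eq_Nil: "prec_trees G F = [] \<longleftrightarrow> G = []"
  by (cases "(G, F)" rule: prec_trees.cases) auto

lift_definition fprec :: "forest \<Rightarrow> forest \<Rightarrow> forest" is prec_trees
  by (simp add: prec_trees_eq_Nil)

definition dual_trees :: "dtree list \<Rightarrow> bool" where
  "dual_trees F \<longleftrightarrow> (\<forall>T\<in>set F. corolla T)
     \<and> (\<forall>i<length F. has_l_edge (F ! i) \<longrightarrow> i = 0)
     \<and> (\<forall>i<length F. has_r_edge (F ! i) \<longrightarrow> i = length F - 1)"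

lift_definition dual_forest :: "forest \<Rightarrow> bool" is dual_trees .

text \<open>The span of the forests which are not in \<open>\<F>\<^sup>!\<close>.\<close>

definition forest_ideal :: "(forest \<Rightarrow>\<^sub>0 'k::field) set" where
  "forest_ideal = pv.span (basis_vec ` {F. \<not> dual_forest F})"

lemma forest_ideal_iff:
  "f \<in> forest_ideal \<longleftrightarrow> Poly_Mapping.keys f \<subseteq> {F. \<not> dual_forest F}"
proof
  assume "f \<in> forest_ideal"
  then show "Poly_Mapping.keys f \<subseteq> {F. \<not> dual_forest F}"
    unfolding forest_ideal_def
  proof (induction rule: pv.span_induct_alt)
    case (step c x y)
    then show ?case using keys_add[of "pscale c x" y] keys_pscale[of c x] by fastforce
  qed simp
next
  assume *: "Poly_Mapping.keys f \<subseteq> {F. \<not> dual_forest F}"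
  have "lin_ext basis_vec f \<in> forest_ideal"
    unfolding lin_ext_def forest_ideal_def using *
    by (intro pv.span_sum pv.span_scale pv.span_base) auto
  then show "f \<in> forest_ideal" by (simp add: basis_vec_expand)
qed

lemma root_dists_0: "0 \<in> root_dists T"
  by (cases T) simp

lemma corolla_B: "corolla (B F G) \<longleftrightarrow> (\<forall>T\<in>set F \<union> set G. T = B [] [])"
proof -
  have *: "(\<forall>d\<in>root_dists T. Suc d \<le> 1) \<longleftrightarrow> T = B [] []" for T
  proof (cases T)
    case (B F' G')
    show ?thesis
    proof (cases "F' = [] \<and> G' = []")
      case False
      then obtain T' where T': "T' \<in> set F' \<union> set G'" by (metis UnCI last_in_set)
      then have "Suc 0 \<in> root_dists T" using root_dists_0[of T'] by (auto simp: B)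
      then show ?thesis using False by (auto simp: B)
    qed (auto simp: B)
  qed
  have "corolla (B F G) \<longleftrightarrow> (\<forall>T\<in>set F \<union> set G. \<forall>d\<in>root_dists T. Suc d \<le> 1)"
    unfolding corolla_def by fastforce
  then show ?thesis by (simp only: *)
qed

lemma dual_trees_iff:
  "dual_trees F \<longleftrightarrow> (\<forall>T\<in>set F. corolla T) \<and> (\<forall>T\<in>set (tl F). \<not> has_l_edge T)
     \<and> (\<forall>T\<in>set (butlast F). \<not> has_r_edge T)"
proof -
  have "(\<forall>i<length F. has_l_edge (F ! i) \<longrightarrow> i = 0) \<longleftrightarrow> (\<forall>T\<in>set (tl F). \<not> has_l_edge T)"
  proof (cases F)
    case (Cons T Ts)
    have "(\<forall>i<Suc (length Ts). has_l_edge (F ! i) \<longrightarrow> i = 0) \<longleftrightarrow>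
        (\<forall>i<length Ts. \<not> has_l_edge (Ts ! i))"
      unfolding All_less_Suc2 by (simp add: Cons)
    then show ?thesis by (simp add: Cons all_set_conv_all_nth)
  qed simp
  moreover have "(\<forall>i<length F. has_r_edge (F ! i) \<longrightarrow> i = length F - 1) \<longleftrightarrow>
      (\<forall>T\<in>set (butlast F). \<not> has_r_edge T)"
  proof (cases F rule: rev_cases)
    case (snoc Ts T)
    have "(\<forall>i<Suc (length Ts). has_r_edge (F ! i) \<longrightarrow> i = length Ts) \<longleftrightarrow>
        (\<forall>i<length Ts. \<not> has_r_edge (F ! i))"
      unfolding All_less_Suc by auto
    also have "\<dots> \<longleftrightarrow> (\<forall>i<length Ts. \<not> has_r_edge (Ts ! i))"
      by (simp add: snoc nth_append)
    finally show ?thesis by (simp add: snoc all_set_conv_all_nth)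
  qed simp
  ultimately show ?thesis unfolding dual_trees_def by blast
qed

lemma dual_trees_bullets:
  assumes "\<And>T. T \<in> set F \<Longrightarrow> T = B [] []"
  shows "dual_trees F"
proof -
  have "set (tl F) \<subseteq> set F" by (cases F) auto
  moreover have "set (butlast F) \<subseteq> set F" by (auto dest: in_set_butlastD)
  moreover have "corolla (B [] [])" "\<not> has_l_edge (B [] [])" "\<not> has_r_edge (B [] [])"
    by (auto simp: corolla_B)
  ultimately show ?thesis unfolding dual_trees_iff using assms by (metis subsetD)
qed

lemma dual_trees_append:
  assumes "dual_trees (xs @ ys)" "xs \<noteq> []" "ys \<noteq> []"
  shows "dual_trees xs" "dual_trees ys"
proof -
  have "set (tl ys) \<subseteq> set ys" by (cases ys) auto
  moreover have "set (butlast xs) \<subseteq> set xs" by (auto dest: in_set_butlastD)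
  ultimately show "dual_trees xs" "dual_trees ys"
    using assms unfolding dual_trees_iff by (simp_all add: butlast_append ball_Un) blast+
qed

lemma dual_trees_succ:
  assumes "dual_trees (succ_trees xs ys)" "ys \<noteq> []"
  shows "dual_trees xs" "dual_trees ys"
proof -
  obtain a b Fs where ys: "ys = B a b # Fs" using assms(2) by (metis dtree.exhaust list.exhaust)
  have 1: "\<forall>T\<in>set xs \<union> set a \<union> set b. T = B [] []"
    using assms(1) by (simp add: ys dual_trees_iff corolla_B)
  then show "dual_trees xs" by (intro dual_trees_bullets) simp
  show "dual_trees ys"
    using assms(1) 1 by (cases "Fs = []") (simp_all add: ys dual_trees_iff corolla_B)
qed

lemma dual_trees_prec:
  assumes "dual_trees (prec_trees xs ys)" "xs \<noteq> []"
  shows "dual_trees xs" "dual_trees ys"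
proof -
  obtain a b Ts where xs: "xs = Ts @ [B a b]" using assms(2) by (metis dtree.exhaust rev_exhaust)
  have 0: "dual_trees (Ts @ [B a (b @ ys)])" using assms(1) by (simp add: xs prec_trees_snoc)
  then have 1: "\<forall>T\<in>set ys \<union> set a \<union> set b. T = B [] []"
    by (simp add: dual_trees_iff corolla_B) blast
  then show "dual_trees ys" by (intro dual_trees_bullets) simp
  show "dual_trees xs"
    using 0 1 by (cases Ts) (auto simp: xs dual_trees_iff corolla_B)
qed

definition preserves_nondual :: "(forest \<Rightarrow> forest \<Rightarrow> forest) \<Rightarrow> bool" where
  "preserves_nondual p \<longleftrightarrow> (\<forall>F G. dual_forest (p F G) \<longrightarrow> dual_forest F \<and> dual_forest G)"

lemma preserves_nondual_fcat: "preserves_nondual fcat"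
  unfolding preserves_nondual_def by transfer (auto dest: dual_trees_append)

lemma preserves_nondual_fsucc: "preserves_nondual fsucc"
  unfolding preserves_nondual_def by transfer (auto dest: dual_trees_succ)

lemma preserves_nondual_fprec: "preserves_nondual fprec"
  unfolding preserves_nondual_def by transfer (auto dest: dual_trees_prec)

lemma forest_ideal_diff: "f \<in> forest_ideal \<Longrightarrow> g \<in> forest_ideal \<Longrightarrow> f - g \<in> forest_ideal"
  and forest_ideal_add: "f \<in> forest_ideal \<Longrightarrow> g \<in> forest_ideal \<Longrightarrow> f + g \<in> forest_ideal"
  and forest_ideal_scale: "f \<in> forest_ideal \<Longrightarrow> pscale c f \<in> forest_ideal"
  and forest_ideal_0: "0 \<in> forest_ideal"
  and forest_ideal_uminus: "f \<in> forest_ideal \<Longrightarrow> - f \<in> forest_ideal"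
  unfolding forest_ideal_def
  by (auto intro: pv.span_diff pv.span_add pv.span_scale pv.span_zero pv.span_neg)

lemma forest_ideal_bilin:
  assumes p: "preserves_nondual p" and f: "f - f' \<in> forest_ideal" and g: "g - g' \<in> forest_ideal"
  shows "bilin_ext p f g - bilin_ext p f' g' \<in> forest_ideal"
proof -
  have "bilin_ext p (f - f') g \<in> forest_ideal" "bilin_ext p f' (g - g') \<in> forest_ideal"
    using p f g unfolding forest_ideal_iff preserves_nondual_def by (intro keys_bilin_ext; blast)+
  from forest_ideal_add[OF this] show ?thesis
    by (simp add: bilin_ext_diff_left bilin_ext_diff_right)
qed

quotient_type (overloaded) 'k dual_forest_alg = "forest \<Rightarrow>\<^sub>0 'k::field" / "\<lambda>f g. f - g \<in> forest_ideal"
  morphisms dfa_rep dfa_class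
proof (rule equivpI)
  show "reflp (\<lambda>f g. f - g \<in> (forest_ideal :: (forest \<Rightarrow>\<^sub>0 'k) set))"
    by (simp add: reflp_def forest_ideal_0)
  show "symp (\<lambda>f g. f - g \<in> (forest_ideal :: (forest \<Rightarrow>\<^sub>0 'k) set))"
    by (auto simp: symp_def dest: forest_ideal_uminus)
  show "transp (\<lambda>f g. f - g \<in> (forest_ideal :: (forest \<Rightarrow>\<^sub>0 'k) set))"
    by (auto simp: transp_def dest: forest_ideal_add)
qed

instantiation dual_forest_alg :: (field) ab_group_add
begin

lift_definition zero_dual_forest_alg :: "'a dual_forest_alg" is 0 .

lift_definition plus_dual_forest_alg ::
  "'a dual_forest_alg \<Rightarrow> 'a dual_forest_alg \<Rightarrow> 'a dual_forest_alg" is "(+)"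
  by (metis add_diff_add forest_ideal_add)

lift_definition minus_dual_forest_alg ::
  "'a dual_forest_alg \<Rightarrow> 'a dual_forest_alg \<Rightarrow> 'a dual_forest_alg" is "(-)"
  by (metis (no_types, lifting) diff_diff_eq2 diff_diff_add add.commute add_diff_eq diff_add_eq forest_ideal_diff)

lift_definition uminus_dual_forest_alg :: "'a dual_forest_alg \<Rightarrow> 'a dual_forest_alg" is uminus
  by (metis forest_ideal_uminus minus_diff_minus)

instance
  by standard (transfer; simp add: forest_ideal_0 algebra_simps)+

end

lift_definition dfa_scale :: "'k::field \<Rightarrow> 'k dual_forest_alg \<Rightarrow> 'k dual_forest_alg" is pscale
  by (metis forest_ideal_scale pv.scale_right_diff_distrib)

interpretation dfa: vector_space dfa_scale
  by unfold_locales (transfer; simp add: forest_ideal_0 algebra_simps)+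

lift_definition dfa_mul ::
  "'k::field dual_forest_alg \<Rightarrow> 'k dual_forest_alg \<Rightarrow> 'k dual_forest_alg" is "bilin_ext fcat"
  by (rule forest_ideal_bilin[OF preserves_nondual_fcat])

lift_definition dfa_succ ::
  "'k::field dual_forest_alg \<Rightarrow> 'k dual_forest_alg \<Rightarrow> 'k dual_forest_alg" is "bilin_ext fsucc"
  by (rule forest_ideal_bilin[OF preserves_nondual_fsucc])

lift_definition dfa_prec ::
  "'k::field dual_forest_alg \<Rightarrow> 'k dual_forest_alg \<Rightarrow> 'k dual_forest_alg" is "bilin_ext fprec"
  by (rule forest_ideal_bilin[OF preserves_nondual_fprec])

lift_definition dfa_bullet :: "'k::field dual_forest_alg" is "basis_vec bullet" .


section \<open>The dual bigraft operad\<close>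

text \<open>
  The free symmetric operad on three binary operations without symmetry: a basis of its
  component of arity \<open>n\<close> consists of the planar binary trees with internal vertices labelled by
  the operations and leaves labelled bijectively by \<open>1, \<dots>, n\<close>. The tree \<open>Node p s t\<close> is the
  operation \<open>s p t\<close>.
\<close>

datatype bgop = Mul | Succ | Prec

datatype 'x optree = Leaf 'x | Node bgop "'x optree" "'x optree"

fun leaves :: "'x optree \<Rightarrow> 'x list" where
  "leaves (Leaf x) = [x]"
| "leaves (Node p s t) = leaves s @ leaves t"

definition op_monomials :: "nat \<Rightarrow> nat optree set" where
  "op_monomials n = {t. distinct (leaves t) \<and> set (leaves t) = {1..n}}"

definition free_op :: "nat \<Rightarrow> (nat optree \<Rightarrow>\<^sub>0 'k::field) set" where
  "free_op n = pv.span (basis_vec ` op_monomials n)"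

text \<open>
  \<open>graft_at i t s\<close> is the partial composition \<open>t \<circ>\<^sub>i s\<close>: the leaf \<open>i\<close> of \<open>t\<close> is replaced by \<open>s\<close>,
  whose leaves are shifted by \<open>i - 1\<close>, and the larger leaves of \<open>t\<close> are shifted by the arity of
  \<open>s\<close> minus one.
\<close>

fun graft_at :: "nat \<Rightarrow> nat optree \<Rightarrow> nat optree \<Rightarrow> nat optree" where
  "graft_at i (Leaf j) s =
     (if j < i then Leaf j
      else if j = i then map_optree (\<lambda>a. a + i - 1) s
      else Leaf (j + length (leaves s) - 1))"
| "graft_at i (Node p t u) s = Node p (graft_at i t s) (graft_at i u s)"

definition op_comp ::
    "nat \<Rightarrow> (nat optree \<Rightarrow>\<^sub>0 'k::field) \<Rightarrow> (nat optree \<Rightarrow>\<^sub>0 'k) \<Rightarrow> (nat optree \<Rightarrow>\<^sub>0 'k)" where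
  "op_comp i = bilin_ext (graft_at i)"

definition op_perm :: "(nat \<Rightarrow> nat) \<Rightarrow> (nat optree \<Rightarrow>\<^sub>0 'k::field) \<Rightarrow> (nat optree \<Rightarrow>\<^sub>0 'k)" where
  "op_perm \<sigma> = lin_ext (\<lambda>t. basis_vec (map_optree \<sigma> t))"

text \<open>\<open>op_left p q\<close> is \<open>(x\<^sub>1 p x\<^sub>2) q x\<^sub>3\<close> and \<open>op_right p q\<close> is \<open>x\<^sub>1 p (x\<^sub>2 q x\<^sub>3)\<close>.\<close>

definition op_left :: "bgop \<Rightarrow> bgop \<Rightarrow> (nat optree \<Rightarrow>\<^sub>0 'k::field)" where
  "op_left p q = basis_vec (Node q (Node p (Leaf 1) (Leaf 2)) (Leaf 3))"

definition op_right :: "bgop \<Rightarrow> bgop \<Rightarrow> (nat optree \<Rightarrow>\<^sub>0 'k::field)" where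
  "op_right p q = basis_vec (Node p (Leaf 1) (Node q (Leaf 2) (Leaf 3)))"

definition bgdual_relations :: "(nat optree \<Rightarrow>\<^sub>0 'k::field) set" where
  "bgdual_relations =
    {op_left Mul Succ - op_right Succ Succ,
     op_left Succ Mul - op_right Succ Mul,
     op_left Prec Prec - op_right Prec Mul,
     op_left Mul Prec - op_right Mul Prec,
     op_left Succ Prec - op_right Succ Prec,
     op_left Mul Mul - op_right Mul Mul,
     op_left Succ Succ, op_left Prec Succ, op_left Prec Mul,
     op_right Prec Prec, op_right Prec Succ, op_right Mul Succ}"

text \<open>The operadic ideal generated by the relations; \<open>op_ideal n\<close> is its component of arity \<open>n\<close>.\<close>

inductive op_ideal :: "nat \<Rightarrow> (nat optree \<Rightarrow>\<^sub>0 'k::field) \<Rightarrow> bool" where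
  relation: "f \<in> bgdual_relations \<Longrightarrow> op_ideal 3 f"
| zero: "op_ideal n 0"
| add: "op_ideal n f \<Longrightarrow> op_ideal n g \<Longrightarrow> op_ideal n (f + g)"
| scale: "op_ideal n f \<Longrightarrow> op_ideal n (pscale c f)"
| perm: "op_ideal n f \<Longrightarrow> \<sigma> permutes {1..n} \<Longrightarrow> op_ideal n (op_perm \<sigma> f)"
| comp_left: "op_ideal m f \<Longrightarrow> g \<in> free_op n \<Longrightarrow> i \<in> {1..m} \<Longrightarrow> op_ideal (m + n - 1) (op_comp i f g)"
| comp_right: "f \<in> free_op m \<Longrightarrow> op_ideal n g \<Longrightarrow> i \<in> {1..m} \<Longrightarrow> op_ideal (m + n - 1) (op_comp i f g)"

text \<open>
  All arities are divided out at once, in order to obtain a single type: the component of arity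
  \<open>n\<close> of the quotient operad is the image \<open>bgdual n\<close> of \<open>free_op n\<close> in this type. As the
  components are independent, it is \<open>free_op n / op_ideal n\<close>; see \<open>bgdual_class_eq_iff\<close>.
\<close>

definition op_ideal_sum :: "(nat optree \<Rightarrow>\<^sub>0 'k::field) set" where
  "op_ideal_sum = pv.span (\<Union>n. Collect (op_ideal n))"

lemma op_ideal_sum_diff: "f \<in> op_ideal_sum \<Longrightarrow> g \<in> op_ideal_sum \<Longrightarrow> f - g \<in> op_ideal_sum"
  and op_ideal_sum_add: "f \<in> op_ideal_sum \<Longrightarrow> g \<in> op_ideal_sum \<Longrightarrow> f + g \<in> op_ideal_sum"
  and op_ideal_sum_scale: "f \<in> op_ideal_sum \<Longrightarrow> pscale c f \<in> op_ideal_sum"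
  and op_ideal_sum_0: "0 \<in> op_ideal_sum"
  and op_ideal_sum_uminus: "f \<in> op_ideal_sum \<Longrightarrow> - f \<in> op_ideal_sum"
  unfolding op_ideal_sum_def
  by (auto intro: pv.span_diff pv.span_add pv.span_scale pv.span_zero pv.span_neg)

quotient_type (overloaded) 'k bgdual_op = "nat optree \<Rightarrow>\<^sub>0 'k::field" / "\<lambda>f g. f - g \<in> op_ideal_sum"
  morphisms bgdual_rep bgdual_class
proof (rule equivpI)
  show "reflp (\<lambda>f g. f - g \<in> (op_ideal_sum :: (nat optree \<Rightarrow>\<^sub>0 'k) set))"
    by (simp add: reflp_def op_ideal_sum_0)
  show "symp (\<lambda>f g. f - g \<in> (op_ideal_sum :: (nat optree \<Rightarrow>\<^sub>0 'k) set))"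
    by (auto simp: symp_def dest: op_ideal_sum_uminus)
  show "transp (\<lambda>f g. f - g \<in> (op_ideal_sum :: (nat optree \<Rightarrow>\<^sub>0 'k) set))"
    by (auto simp: transp_def dest: op_ideal_sum_add)
qed

instantiation bgdual_op :: (field) ab_group_add
begin

lift_definition zero_bgdual_op :: "'a bgdual_op" is 0 .

lift_definition plus_bgdual_op :: "'a bgdual_op \<Rightarrow> 'a bgdual_op \<Rightarrow> 'a bgdual_op" is "(+)"
  by (metis add_diff_add op_ideal_sum_add)

lift_definition minus_bgdual_op :: "'a bgdual_op \<Rightarrow> 'a bgdual_op \<Rightarrow> 'a bgdual_op" is "(-)"
  by (metis (no_types, lifting) diff_diff_eq2 diff_diff_add add.commute add_diff_eq diff_add_eq op_ideal_sum_diff)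

lift_definition uminus_bgdual_op :: "'a bgdual_op \<Rightarrow> 'a bgdual_op" is uminus
  by (metis op_ideal_sum_uminus minus_diff_minus)

instance
  by standard (transfer; simp add: op_ideal_sum_0 algebra_simps)+

end

lift_definition bgdual_scale :: "'k::field \<Rightarrow> 'k bgdual_op \<Rightarrow> 'k bgdual_op" is pscale
  by (metis op_ideal_sum_scale pv.scale_right_diff_distrib)

interpretation bgd: vector_space bgdual_scale
  by unfold_locales (transfer; simp add: op_ideal_sum_0 algebra_simps)+

definition bgdual :: "nat \<Rightarrow> 'k::field bgdual_op set" where
  "bgdual n = bgdual_class ` free_op n"

lemma free_op_iff: "f \<in> free_op n \<longleftrightarrow> Poly_Mapping.keys f \<subseteq> op_monomials n"
proof
  assume "f \<in> free_op n"
  then show "Poly_Mapping.keys f \<subseteq> op_monomials n"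
    unfolding free_op_def
  proof (induction rule: pv.span_induct_alt)
    case (step c x y)
    then show ?case using keys_add[of "pscale c x" y] keys_pscale[of c x] by fastforce
  qed simp
next
  assume *: "Poly_Mapping.keys f \<subseteq> op_monomials n"
  have "lin_ext basis_vec f \<in> free_op n"
    unfolding lin_ext_def free_op_def using *
    by (intro pv.span_sum pv.span_scale pv.span_base) auto
  then show "f \<in> free_op n" by (simp add: basis_vec_expand)
qed

lemma op_monomials_disjoint: "t \<in> op_monomials m \<Longrightarrow> t \<in> op_monomials n \<Longrightarrow> m = n"
  by (metis (mono_tags, lifting) card_atLeastAtMost diff_Suc_1 mem_Collect_eq op_monomials_def)

lemma leaves_map_optree: "leaves (map_optree h t) = map h (leaves t)"
  by (induction t) auto

lemma leaves_graft_at: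
  "leaves (graft_at i t s) = concat (map (\<lambda>j. if j < i then [j]
     else if j = i then map (\<lambda>a. a + i - 1) (leaves s) else [j + length (leaves s) - 1]) (leaves t))"
  by (induction t) (auto simp: leaves_map_optree)

lemma op_monomials_mset: "t \<in> op_monomials n \<longleftrightarrow> mset (leaves t) = mset [1..<Suc n]"
proof -
  have "mset (leaves t) = mset [1..<Suc n] \<longleftrightarrow> distinct (leaves t) \<and> set (leaves t) = set [1..<Suc n]"
    by (metis distinct_upt mset_eq_imp_distinct_iff set_eq_iff_mset_eq_distinct)
  moreover have "set [1..<Suc n] = {1..n}" by (simp only: set_upt atLeastLessThanSuc_atLeastAtMost)
  ultimately show ?thesis by (simp only: op_monomials_def mem_Collect_eq)
qed

lemma map_shift_upt: "map (\<lambda>i. i + d) [a..<b] = [a + d..<b + d]" for a b d :: nat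
  by (induction b) auto

lemma graft_at_monomial:
  assumes t: "t \<in> op_monomials m" and s: "s \<in> op_monomials n" and i: "i \<in> {1..m}"
  shows "graft_at i t s \<in> op_monomials (m + n - 1)"
proof -
  have "mset (leaves s) = mset [1..<Suc n]" using s by (simp only: op_monomials_mset)
  from arg_cong[OF this, of size] have ns: "length (leaves s) = n"
    by (simp only: size_mset length_upt diff_Suc_1 One_nat_def)
  have "leaves s \<noteq> []" by (induction s) auto
  with ns have n: "n \<ge> 1" by (cases n) auto
  define e where "e j = (if j < i then [j]
     else if j = i then map (\<lambda>a. a + i - 1) (leaves s) else [j + length (leaves s) - 1])" for j
  have mset_e: "mset (concat (map e xs)) = (\<Sum>j\<in>#mset xs. mset (e j))" for xs
    by (induction xs) auto
  have split1: "[1..<Suc m] = [1..<i] @ [i..<Suc m]"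
    using upt_add_eq_append[of 1 i "Suc m - i"] i by (simp del: upt_Suc)
  have split2: "[i..<Suc m] = i # [Suc i..<Suc m]"
    using i by (intro upt_conv_Cons) simp
  have "[1..<i] @ [i..<i + n] @ [i + n..<m + n] = [1..<m + n]"
    using upt_add_eq_append[of 1 i "m + n - i"] upt_add_eq_append[of i "i + n" "m - i"] i by (simp add: add.commute[of n m])
  then have split3: "[1..<i] @ [i..<i + n] @ [i + n..<m + n] = [1..<Suc (m + n - 1)]"
    using n by simp
  have "map e [1..<i] = map (\<lambda>j. [j]) [1..<i]" by (simp add: e_def)
  then have e1: "concat (map e [1..<i]) = [1..<i]" by (simp del: map_eq_conv)
  have "map e [Suc i..<Suc m] = map (\<lambda>j. [j + (n - 1)]) [Suc i..<Suc m]"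
    using n by (intro map_cong refl) (auto simp: e_def ns simp del: upt_Suc)
  then have "concat (map e [Suc i..<Suc m]) = map (\<lambda>j. j + (n - 1)) [Suc i..<Suc m]"
    by (simp only: concat_map_singleton)
  also have "\<dots> = [i + n..<m + n]"
    unfolding map_shift_upt using n by simp
  finally have e3: "concat (map e [Suc i..<Suc m]) = [i + n..<m + n]" .
  have "mset (e i) = image_mset (\<lambda>a. a + i - 1) (mset (leaves s))"
    by (simp add: e_def)
  also have "\<dots> = mset (map (\<lambda>a. a + i - 1) [1..<Suc n])"
    using s unfolding op_monomials_mset by (simp only: mset_map)
  also have "map (\<lambda>a. a + i - 1) [1..<Suc n] = map (\<lambda>a. a + (i - 1)) [1..<Suc n]"
    using i by (intro map_cong refl) auto
  also have "\<dots> = [i..<i + n]"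
    unfolding map_shift_upt using i by (simp add: add.commute[of n i])
  finally have e2: "mset (e i) = mset [i..<i + n]" .
  have "mset (leaves (graft_at i t s)) = mset (concat (map e (leaves t)))"
    unfolding leaves_graft_at e_def ..
  also have "\<dots> = mset (concat (map e [1..<Suc m]))"
    using t unfolding mset_e op_monomials_mset by (simp only:)
  also have "\<dots> = mset ([1..<i] @ [i..<i + n] @ [i + n..<m + n])"
    unfolding split1 split2 by (simp only: map_append concat_append list.map concat.simps mset_append e1 e2 e3)
  finally show ?thesis unfolding op_monomials_mset split3 .
qed

lemma basis_vec_free_op [simp]: "basis_vec t \<in> free_op n \<longleftrightarrow> t \<in> op_monomials n"
  by (simp add: free_op_iff)

lemma map_optree_monomial:
  assumes "\<sigma> permutes {1..n}" "t \<in> op_monomials n"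
  shows "map_optree \<sigma> t \<in> op_monomials n"
  using assms permutes_inj_on[OF assms(1)] permutes_image[OF assms(1)]
  by (simp add: op_monomials_def leaves_map_optree distinct_map)

lemma free_op_diff: "f \<in> free_op n \<Longrightarrow> g \<in> free_op n \<Longrightarrow> f - g \<in> free_op n"
  unfolding free_op_def by (rule pv.span_diff)

lemma relations_free_op:
  assumes "f \<in> bgdual_relations" shows "f \<in> free_op 3"
proof -
  have "op_left p q \<in> free_op 3" "op_right p q \<in> free_op 3" for p q
    by (auto simp: op_left_def op_right_def op_monomials_def)
  with assms show ?thesis unfolding bgdual_relations_def by (auto intro: free_op_diff)
qed

lemma op_ideal_free_op: "op_ideal n f \<Longrightarrow> f \<in> free_op n"
proof (induction rule: op_ideal.induct)
  case (relation f)
  then show ?case by (rule relations_free_op)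
next
  case (zero n)
  then show ?case by (simp add: free_op_def pv.span_zero)
next
  case (add n f g)
  then show ?case by (simp add: free_op_def pv.span_add)
next
  case (scale n f c)
  then show ?case by (simp add: free_op_def pv.span_scale)
next
  case (perm n f \<sigma>)
  then have "Poly_Mapping.keys (op_perm \<sigma> f) \<subseteq> op_monomials n"
    unfolding op_perm_def free_op_iff
    by (intro keys_lin_ext) (simp add: map_optree_monomial subsetD)
  then show ?case by (simp add: free_op_iff)
next
  case (comp_left m f g n i)
  then show ?case unfolding op_comp_def free_op_iff
    by (intro keys_bilin_ext) (meson graft_at_monomial subsetD)
next
  case (comp_right f m n g i)
  then show ?case unfolding op_comp_def free_op_iff
    by (intro keys_bilin_ext) (meson graft_at_monomial subsetD)
qed

definition arity_part :: "nat \<Rightarrow> (nat optree \<Rightarrow>\<^sub>0 'k::field) \<Rightarrow> (nat optree \<Rightarrow>\<^sub>0 'k)" where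
  "arity_part n = lin_ext (\<lambda>t. if t \<in> op_monomials n then basis_vec t else 0)"

lemma lin_ext_cong:
  assumes "\<And>x. x \<in> Poly_Mapping.keys f \<Longrightarrow> h x = h' x"
  shows "lin_ext h f = lin_ext h' f"
  unfolding lin_ext_def using assms by (intro sum.cong) simp_all

lemma arity_part_same:
  assumes "f \<in> free_op n" shows "arity_part n f = f"
proof -
  have "arity_part n f = lin_ext basis_vec f"
    unfolding arity_part_def using assms by (intro lin_ext_cong) (auto simp: free_op_iff)
  then show ?thesis by (simp add: basis_vec_expand)
qed

lemma arity_part_other:
  assumes "f \<in> free_op m" "m \<noteq> n" shows "arity_part n f = 0"
proof -
  have "arity_part n f = lin_ext (\<lambda>_. 0) f"
    unfolding arity_part_def using assms op_monomials_disjoint[of _ m n]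
    by (intro lin_ext_cong) (auto simp: free_op_iff)
  then show ?thesis by (simp add: lin_ext_def)
qed

lemma arity_part_ideal: "f \<in> op_ideal_sum \<Longrightarrow> op_ideal n (arity_part n f)"
  unfolding op_ideal_sum_def
proof (induction rule: pv.span_induct_alt)
  case base
  show ?case by (simp add: arity_part_def op_ideal.zero)
next
  case (step c x y)
  then obtain m where m: "op_ideal m x" by auto
  have "op_ideal n (arity_part n x)"
  proof (cases "m = n")
    case True
    then show ?thesis using m by (simp add: arity_part_same op_ideal_free_op)
  next
    case False
    then show ?thesis using arity_part_other[OF op_ideal_free_op[OF m]] by (simp add: op_ideal.zero)
  qed
  then show ?case using step(2)
    by (simp add: arity_part_def lin_ext_add lin_ext_scale op_ideal.add op_ideal.scale)
qed

lemma bgdual_class_eq_iff: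
  assumes "f \<in> free_op n" "g \<in> free_op n"
  shows "bgdual_class f = bgdual_class g \<longleftrightarrow> op_ideal n (f - g)"
proof -
  have "f - g \<in> op_ideal_sum \<longleftrightarrow> op_ideal n (f - g)"
    using arity_part_ideal[of "f - g" n] arity_part_same[OF free_op_diff[OF assms]]
    by (auto simp: op_ideal_sum_def intro: pv.span_base)
  then show ?thesis by (simp add: bgdual_op.abs_eq_iff)
qed

text \<open>
  The action of \<open>\<sigma> \<in> S\<^sub>n\<close> by relabelling the leaves. It concerns the component of arity \<open>n\<close>
  only, and is extended by the identity to the other ones; see \<open>bgdual_perm_class\<close>.
\<close>

definition arity_perm ::
    "nat \<Rightarrow> (nat \<Rightarrow> nat) \<Rightarrow> (nat optree \<Rightarrow>\<^sub>0 'k::field) \<Rightarrow> (nat optree \<Rightarrow>\<^sub>0 'k)" where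
  "arity_perm n \<sigma> = lin_ext (\<lambda>t. basis_vec
     (if \<sigma> permutes {1..n} \<and> t \<in> op_monomials n then map_optree \<sigma> t else t))"

lemma arity_perm_same:
  assumes "\<sigma> permutes {1..n}" "f \<in> free_op n"
  shows "arity_perm n \<sigma> f = op_perm \<sigma> f"
  unfolding arity_perm_def op_perm_def
proof (rule lin_ext_cong)
  fix t assume "t \<in> Poly_Mapping.keys f"
  with assms(2) have "t \<in> op_monomials n" by (auto simp: free_op_iff)
  with assms(1) show "basis_vec (if \<sigma> permutes {1..n} \<and> t \<in> op_monomials n then map_optree \<sigma> t else t) =
      basis_vec (map_optree \<sigma> t)" by simp
qed

lemma arity_perm_other:
  fixes f :: "nat optree \<Rightarrow>\<^sub>0 'k::field"
  assumes "f \<in> free_op m" "m \<noteq> n \<or> \<not> \<sigma> permutes {1..n}"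
  shows "arity_perm n \<sigma> f = f"
proof -
  have "arity_perm n \<sigma> f = lin_ext basis_vec f"
    unfolding arity_perm_def
  proof (rule lin_ext_cong)
    fix t assume "t \<in> Poly_Mapping.keys f"
    with assms(1) have "t \<in> op_monomials m" by (auto simp: free_op_iff)
    with assms(2) have "\<not> (\<sigma> permutes {1..n} \<and> t \<in> op_monomials n)"
      by (blast dest: op_monomials_disjoint)
    then show "basis_vec (if \<sigma> permutes {1..n} \<and> t \<in> op_monomials n then map_optree \<sigma> t else t) =
        (basis_vec t :: nat optree \<Rightarrow>\<^sub>0 'k)" by (simp only: if_False)
  qed
  then show ?thesis by (simp add: basis_vec_expand)
qed

lemma arity_perm_ideal: "f \<in> op_ideal_sum \<Longrightarrow> arity_perm n \<sigma> f \<in> op_ideal_sum"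
  unfolding op_ideal_sum_def
proof (induction rule: pv.span_induct_alt)
  case base
  show ?case by (simp add: arity_perm_def pv.span_zero)
next
  case (step c x y)
  then obtain m where m: "op_ideal m x" by auto
  have "arity_perm n \<sigma> x \<in> (\<Union>n. Collect (op_ideal n))"
  proof (cases "m = n \<and> \<sigma> permutes {1..n}")
    case True
    then have "op_ideal n (arity_perm n \<sigma> x)"
      using m by (simp add: arity_perm_same op_ideal_free_op op_ideal.perm)
    then show ?thesis by auto
  next
    case False
    then show ?thesis using arity_perm_other[OF op_ideal_free_op[OF m], of n \<sigma>] m by auto
  qed
  then show ?case using step(2)
    by (simp add: arity_perm_def lin_ext_add lin_ext_scale pv.span_add pv.span_scale pv.span_base)
qed

lemma arity_perm_diff: "arity_perm n \<sigma> (f - g) = arity_perm n \<sigma> f - arity_perm n \<sigma> g"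
  by (simp add: arity_perm_def lin_ext_diff)

lift_definition bgdual_perm :: "nat \<Rightarrow> (nat \<Rightarrow> nat) \<Rightarrow> 'k::field bgdual_op \<Rightarrow> 'k bgdual_op"
  is arity_perm
  by (simp only: arity_perm_diff[symmetric] arity_perm_ideal)

lemma bgdual_perm_class:
  assumes "\<sigma> permutes {1..n}" "f \<in> free_op n"
  shows "bgdual_perm n \<sigma> (bgdual_class f) = bgdual_class (op_perm \<sigma> f)"
  using arity_perm_same[OF assms] by (simp add: bgdual_perm.abs_eq)

text \<open>The group algebra \<open>\<K>[S\<^sub>n]\<close> and its action on the component of arity \<open>n\<close>.\<close>

definition group_algebra :: "nat \<Rightarrow> ((nat \<Rightarrow> nat) \<Rightarrow> 'k::field) set" where
  "group_algebra n = {\<alpha>. \<forall>\<sigma>. \<not> \<sigma> permutes {1..n} \<longrightarrow> \<alpha> \<sigma> = 0}"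

definition group_algebra_act ::
    "nat \<Rightarrow> ((nat \<Rightarrow> nat) \<Rightarrow> 'k::field) \<Rightarrow> 'k bgdual_op \<Rightarrow> 'k bgdual_op" where
  "group_algebra_act n \<alpha> x =
     (\<Sum>\<sigma> | \<sigma> permutes {1..n}. bgdual_scale (\<alpha> \<sigma>) (bgdual_perm n \<sigma> x))"

definition freely_generates :: "nat \<Rightarrow> 'i set \<Rightarrow> ('i \<Rightarrow> 'k::field bgdual_op) \<Rightarrow> bool" where
  "freely_generates n J c \<longleftrightarrow>
     (\<forall>j\<in>J. c j \<in> bgdual n) \<and>
     (\<forall>x\<in>bgdual n. \<exists>!\<alpha>. \<alpha> \<in> J \<rightarrow>\<^sub>E group_algebra n \<and>
        x = (\<Sum>j\<in>J. group_algebra_act n (\<alpha> j) (c j)))"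

definition comb_label :: "nat \<Rightarrow> nat \<Rightarrow> nat \<Rightarrow> bgop" where
  "comb_label l k j = (if j < l then Mul else if j = l then Succ else if j \<le> k then Mul else Prec)"

definition left_comb :: "nat \<Rightarrow> nat \<Rightarrow> nat \<Rightarrow> nat optree" where
  "left_comb n l k = foldl (\<lambda>t j. Node (comb_label l k j) t (Leaf j)) (Leaf 1) [2..<Suc n]"

definition bgdual_comb :: "nat \<Rightarrow> nat \<times> nat \<Rightarrow> 'k::field bgdual_op" where
  "bgdual_comb n = (\<lambda>(l, k). bgdual_class (basis_vec (left_comb n l k)))"

definition comb_indices :: "nat \<Rightarrow> (nat \<times> nat) set" where
  "comb_indices n = {(l, k). 1 \<le> l \<and> l \<le> k \<and> k \<le> n}"

end

theory Submission
  imports Defs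
begin

text \<open>
  The six associativity relations and the six vanishing relations rewrite every product of
  letters either to zero or to a normal form \<open>(u \<succ> v) \<prec> w\<close> with lists of letters \<open>u\<close>, \<open>v\<close>,
  \<open>w\<close>, where \<open>v\<close> is not empty and lists are multiplied by \<open>\<ast>\<close>. These words, with a zero
  added, are closed under formal products (\<open>word_op\<close>), which satisfy the relations
  (\<open>word_op_identities\<close>), and words multiply in every \<open>\<B>\<G>\<^sup>!\<close>-algebra as they do formally
  (\<open>word_eval_op\<close>). The words therefore describe the free algebras, and everything
  else is a translation to this model.

  Over one letter, a word is given by the lengths of its lists, and it corresponds to the
  forest of \<open>\<F>\<^sup>!\<close> with as many roots as \<open>v\<close> has letters, on whose first and last roots the
  letters of \<open>u\<close> and \<open>w\<close> are grafted. A product of two such forests leaves \<open>\<F>\<^sup>!\<close> exactly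
  when the product of the words is zero (\<open>forest_word_op\<close>). So \<open>\<M>\<^sup>!\<close> has the structure
  constants of the words, and the evaluation of words at \<open>a\<close> is the morphism sending \<open>\<bullet>\<close> to \<open>a\<close>.

  In the operad the words in the letters \<open>1, \<dots>, n\<close>, each used once, correspond to the
  relabelled left combs. They span, because the sum of the components of the operad is itself a
  \<open>\<B>\<G>\<^sup>!\<close>-algebra under \<open>(f, g) \<mapsto> (p \<circ>\<^sub>2 g) \<circ>\<^sub>1 f\<close>, in which a tree reduces to a comb or to zero
  (\<open>tree_class_conv_comb\<close>). They are independent, because operations of the ideal vanish in every
  algebra (\<open>op_ideal_vanishes\<close>), in particular in the algebra of words, where distinct combs have
  distinct words as values. Such a word is a permutation of \<open>1, \<dots>, n\<close> together with the two
  places \<open>1 \<le> l \<le> k \<le> n\<close> where its lists are cut, hence the dimension and the freeness over \<open>S\<^sub>n\<close>.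
\<close>

section \<open>Linear maps out of a vector space with a given basis\<close>

text \<open>The extension \<open>lin_ext\<close> with values in an arbitrary vector space instead of one with a basis.\<close>

definition vec_ext ::
    "('k::field \<Rightarrow> 'a::ab_group_add \<Rightarrow> 'a) \<Rightarrow> ('x \<Rightarrow> 'a) \<Rightarrow> ('x \<Rightarrow>\<^sub>0 'k) \<Rightarrow> 'a" where
  "vec_ext scale h f = (\<Sum>x\<in>Poly_Mapping.keys f. scale (Poly_Mapping.lookup f x) (h x))"

lemma lin_ext_conv_vec_ext: "lin_ext h = vec_ext pscale h"
  by (simp add: fun_eq_iff lin_ext_def vec_ext_def)

context vector_space
begin

lemma vec_ext_superset:
  assumes "finite A" "Poly_Mapping.keys f \<subseteq> A"
  shows "vec_ext scale h f = (\<Sum>x\<in>A. scale (Poly_Mapping.lookup f x) (h x))"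
  unfolding vec_ext_def using assms
  by (intro sum.mono_neutral_left) (auto simp: in_keys_iff)

lemma vec_ext_add: "vec_ext scale h (f + g) = vec_ext scale h f + vec_ext scale h g"
proof -
  let ?A = "Poly_Mapping.keys f \<union> Poly_Mapping.keys g"
  have "Poly_Mapping.keys (f + g) \<subseteq> ?A" by (rule keys_add)
  then show ?thesis
    by (simp add: vec_ext_superset[of ?A] lookup_add scale_left_distrib sum.distrib)
qed

lemma vec_ext_scale: "vec_ext scale h (pscale c f) = scale c (vec_ext scale h f)"
  using keys_pscale[of c f]
  by (simp add: vec_ext_superset[of "Poly_Mapping.keys f"] scale_sum_right)

lemma linear_vec_ext: "Vector_Spaces.linear pscale scale (vec_ext scale h)"
  by (simp add: Vector_Spaces.linear_iff vec_ext_add vec_ext_scale vector_space_axioms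
      pv.vector_space_axioms)

lemma vec_ext_0 [simp]: "vec_ext scale h 0 = 0"
  by (simp add: vec_ext_def)

lemma vec_ext_diff: "vec_ext scale h (f - g) = vec_ext scale h f - vec_ext scale h g"
  by (metis add_diff_cancel_right' diff_add_cancel vec_ext_add)

lemma vec_ext_basis_vec [simp]: "vec_ext scale h (basis_vec x) = h x"
  by (simp add: vec_ext_def basis_vec_def)

end

lemma span_basis_vecs: "pv.span (range basis_vec) = (UNIV :: ('x \<Rightarrow>\<^sub>0 'k::field) set)"
proof -
  have "lin_ext basis_vec f \<in> pv.span (range basis_vec)" for f :: "'x \<Rightarrow>\<^sub>0 'k"
    unfolding lin_ext_def by (intro pv.span_sum pv.span_scale pv.span_base) auto
  then show ?thesis by (auto simp: basis_vec_expand)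
qed

lemma linear_eq_on_spanning:
  assumes "Vector_Spaces.linear s1 s2 f" "Vector_Spaces.linear s1 s2 g"
    and "module.span s1 S = UNIV" "\<And>x. x \<in> S \<Longrightarrow> f x = g x"
  shows "f x = g x"
proof -
  interpret f: Vector_Spaces.linear s1 s2 f by fact
  interpret vector_space_pair s1 s2 ..
  show ?thesis
    using linear_eq_on_span[OF assms(1,2), of S x] assms(3,4) by auto
qed

lemma linear_eq_on_basis:
  assumes "Vector_Spaces.linear pscale s f" "Vector_Spaces.linear pscale s g"
    and "\<And>x. f (basis_vec x) = g (basis_vec x)"
  shows "f v = g v"
  by (rule linear_eq_on_spanning[OF assms(1,2) span_basis_vecs]) (use assms(3) in auto)


section \<open>The relations, uniformly in the three operations\<close>

text \<open>
  All relations of a \<open>\<B>\<G>\<^sup>!\<close>-algebra are monomial or binomial: each composite of two operations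
  bracketed to the left either equals one bracketed to the right or vanishes. Listing the
  labels once lets the same table serve for algebras, for words, and for the generators of
  the operadic ideal.
\<close>

definition assoc_ops :: "(bgop \<times> bgop \<times> bgop \<times> bgop) set" where
  "assoc_ops = {(Mul, Succ, Succ, Succ), (Succ, Mul, Succ, Mul), (Prec, Prec, Prec, Mul),
     (Mul, Prec, Mul, Prec), (Succ, Prec, Succ, Prec), (Mul, Mul, Mul, Mul)}"

definition left_zero_ops :: "(bgop \<times> bgop) set" where
  "left_zero_ops = {(Succ, Succ), (Prec, Succ), (Prec, Mul)}"

definition right_zero_ops :: "(bgop \<times> bgop) set" where
  "right_zero_ops = {(Prec, Prec), (Prec, Succ), (Mul, Succ)}"

definition bgdual_identities :: "(bgop \<Rightarrow> 'a \<Rightarrow> 'a \<Rightarrow> 'a) \<Rightarrow> 'a \<Rightarrow> 'a set \<Rightarrow> bool" where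
  "bgdual_identities m e S \<longleftrightarrow> (\<forall>x\<in>S. \<forall>y\<in>S. \<forall>z\<in>S.
     (\<forall>(p, q, r, s)\<in>assoc_ops. m q (m p x y) z = m r x (m s y z)) \<and>
     (\<forall>(p, q)\<in>left_zero_ops. m q (m p x y) z = e) \<and>
     (\<forall>(p, q)\<in>right_zero_ops. m p x (m q y z) = e))"

lemma bgdual_identitiesD:
  assumes "bgdual_identities m e S" "x \<in> S" "y \<in> S" "z \<in> S"
  shows "(p, q, r, s) \<in> assoc_ops \<Longrightarrow> m q (m p x y) z = m r x (m s y z)"
    and "(p, q) \<in> left_zero_ops \<Longrightarrow> m q (m p x y) z = e"
    and "(p, q) \<in> right_zero_ops \<Longrightarrow> m p x (m q y z) = e"
  using assms(1)[unfolded bgdual_identities_def, THEN bspec, OF assms(2), THEN bspec, OF assms(3),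
      THEN bspec, OF assms(4)]
  by auto

lemma bgdual_relations_conv:
  "bgdual_relations = {op_left p q - op_right r s | p q r s. (p, q, r, s) \<in> assoc_ops}
     \<union> {op_left p q | p q. (p, q) \<in> left_zero_ops} \<union> {op_right p q | p q. (p, q) \<in> right_zero_ops}"
  unfolding bgdual_relations_def assoc_ops_def left_zero_ops_def right_zero_ops_def by auto

locale bilinear_ops = vector_space scale
  for scale :: "'k::field \<Rightarrow> 'a::ab_group_add \<Rightarrow> 'a" +
  fixes opr :: "bgop \<Rightarrow> 'a \<Rightarrow> 'a \<Rightarrow> 'a"
  assumes linear_left: "\<And>p y. Vector_Spaces.linear scale scale (\<lambda>x. opr p x y)"
    and linear_right: "\<And>p x. Vector_Spaces.linear scale scale (opr p x)"
begin

lemma opr_add_left: "opr p (x + x') y = opr p x y + opr p x' y"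
  and opr_scale_left: "opr p (scale c x) y = scale c (opr p x y)"
  using linear_left[of p y] by (simp_all add: Vector_Spaces.linear_iff)

lemma opr_add_right: "opr p x (y + y') = opr p x y + opr p x y'"
  and opr_scale_right: "opr p x (scale c y) = scale c (opr p x y)"
  using linear_right[of p x] by (simp_all add: Vector_Spaces.linear_iff)

lemma opr_0_left [simp]: "opr p 0 y = 0" and opr_0_right [simp]: "opr p x 0 = 0"
  using opr_scale_left[of p 0 0 y] opr_scale_right[of p x 0 0] by simp_all

lemma trilinear_eq_on_spanning:
  assumes "span S = UNIV"
    and "\<And>y z. Vector_Spaces.linear scale scale (\<lambda>x. F x y z)"
      "\<And>x z. Vector_Spaces.linear scale scale (\<lambda>y. F x y z)"
      "\<And>x y. Vector_Spaces.linear scale scale (\<lambda>z. F x y z)"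
    and "\<And>y z. Vector_Spaces.linear scale scale (\<lambda>x. G x y z)"
      "\<And>x z. Vector_Spaces.linear scale scale (\<lambda>y. G x y z)"
      "\<And>x y. Vector_Spaces.linear scale scale (\<lambda>z. G x y z)"
    and eq: "\<And>x y z. x \<in> S \<Longrightarrow> y \<in> S \<Longrightarrow> z \<in> S \<Longrightarrow> F x y z = G x y z"
  shows "F x y z = G x y z"
proof -
  have 1: "F x y z = G x y z" if "x \<in> S" "y \<in> S" for x y z
    by (rule linear_eq_on_spanning[OF assms(4,7,1)]) (use eq that in auto)
  have 2: "F x y z = G x y z" if "x \<in> S" for x y z
    by (rule linear_eq_on_spanning[OF assms(3,6,1)]) (use 1 that in auto)
  show ?thesis
    by (rule linear_eq_on_spanning[OF assms(2,5,1)]) (use 2 in auto)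
qed

text \<open>Both sides of every relation are linear in each of the three arguments.\<close>

lemma identities_from_spanning:
  assumes S: "span S = UNIV" and id: "bgdual_identities opr 0 S"
  shows "bgdual_identities opr 0 UNIV"
proof -
  note lin = Vector_Spaces.linear_iff vector_space_axioms opr_add_left opr_add_right
    opr_scale_left opr_scale_right scale_right_distrib
  have "opr q (opr p x y) z = opr r x (opr s y z)" if "(p, q, r, s) \<in> assoc_ops" for p q r s x y z
    by (rule trilinear_eq_on_spanning[OF S, where F = "\<lambda>x y z. opr q (opr p x y) z"
          and G = "\<lambda>x y z. opr r x (opr s y z)"])
      (simp_all add: lin bgdual_identitiesD(1)[OF id _ _ _ that])
  moreover have "opr q (opr p x y) z = 0" if "(p, q) \<in> left_zero_ops" for p q x y z
    by (rule trilinear_eq_on_spanning[OF S, where F = "\<lambda>x y z. opr q (opr p x y) z"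
          and G = "\<lambda>_ _ _. 0"])
      (simp_all add: lin bgdual_identitiesD(2)[OF id _ _ _ that])
  moreover have "opr p x (opr q y z) = 0" if "(p, q) \<in> right_zero_ops" for p q x y z
    by (rule trilinear_eq_on_spanning[OF S, where F = "\<lambda>x y z. opr p x (opr q y z)"
          and G = "\<lambda>_ _ _. 0"])
      (simp_all add: lin bgdual_identitiesD(3)[OF id _ _ _ that])
  ultimately show ?thesis unfolding bgdual_identities_def by blast
qed

end

locale bgdual_ops = bilinear_ops scale opr
  for scale :: "'k::field \<Rightarrow> 'a::ab_group_add \<Rightarrow> 'a" and opr :: "bgop \<Rightarrow> 'a \<Rightarrow> 'a \<Rightarrow> 'a" +
  assumes identities: "bgdual_identities opr 0 UNIV"
begin

lemma opr_assoc: "(p, q, r, s) \<in> assoc_ops \<Longrightarrow> opr q (opr p x y) z = opr r x (opr s y z)"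
  and opr_left_zero: "(p, q) \<in> left_zero_ops \<Longrightarrow> opr q (opr p x y) z = 0"
  and opr_right_zero: "(p, q) \<in> right_zero_ops \<Longrightarrow> opr p x (opr q y z) = 0"
  using bgdual_identitiesD[OF identities UNIV_I UNIV_I UNIV_I] by blast+

end

fun bg_opr :: "('a \<Rightarrow> 'a \<Rightarrow> 'a) \<Rightarrow> ('a \<Rightarrow> 'a \<Rightarrow> 'a) \<Rightarrow> ('a \<Rightarrow> 'a \<Rightarrow> 'a) \<Rightarrow> bgop \<Rightarrow> 'a \<Rightarrow> 'a \<Rightarrow> 'a" where
  "bg_opr mul succ prec Mul = mul"
| "bg_opr mul succ prec Succ = succ"
| "bg_opr mul succ prec Prec = prec"

lemma bgdual_algebra_iff_ops:
  "bgdual_algebra scale mul succ prec \<longleftrightarrow> bgdual_ops scale (bg_opr mul succ prec)"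
proof
  assume "bgdual_algebra scale mul succ prec"
  then interpret bgdual_algebra scale mul succ prec .
  show "bgdual_ops scale (bg_opr mul succ prec)"
  proof (intro bgdual_ops.intro bilinear_ops.intro bilinear_ops_axioms.intro
      bgdual_ops_axioms.intro vector_space_axioms)
    show "Vector_Spaces.linear scale scale (\<lambda>x. bg_opr mul succ prec p x y)" for p y
      by (cases p) (simp_all add: mul_linear succ_linear prec_linear)
    show "Vector_Spaces.linear scale scale (bg_opr mul succ prec p x)" for p x
      by (cases p) (simp_all add: mul_linear succ_linear prec_linear)
    show "bgdual_identities (bg_opr mul succ prec) 0 UNIV"
      unfolding bgdual_identities_def assoc_ops_def left_zero_ops_def right_zero_ops_def
      by (simp add: mul_succ succ_mul prec_prec mul_prec succ_prec mul_mul succ_succ_0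
          prec_succ_0 prec_mul_0 prec_prec_0 prec_succ'_0 mul_succ'_0)
  qed
next
  assume "bgdual_ops scale (bg_opr mul succ prec)"
  then interpret bgdual_ops scale "bg_opr mul succ prec" .
  note lin = linear_left[of Mul] linear_left[of Succ] linear_left[of Prec]
    linear_right[of Mul] linear_right[of Succ] linear_right[of Prec]
  note id =
    opr_assoc[of Mul Succ Succ Succ] opr_assoc[of Succ Mul Succ Mul]
    opr_assoc[of Prec Prec Prec Mul] opr_assoc[of Mul Prec Mul Prec]
    opr_assoc[of Succ Prec Succ Prec] opr_assoc[of Mul Mul Mul Mul]
    opr_left_zero[of Succ Succ] opr_left_zero[of Prec Succ] opr_left_zero[of Prec Mul]
    opr_right_zero[of Prec Prec] opr_right_zero[of Prec Succ] opr_right_zero[of Mul Succ]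
  show "bgdual_algebra scale mul succ prec"
    by (intro bgdual_algebra.intro bgdual_algebra_axioms.intro vector_space_axioms;
        (rule lin[unfolded bg_opr.simps] | rule id[unfolded bg_opr.simps])?)
      (simp_all add: assoc_ops_def left_zero_ops_def right_zero_ops_def)
qed


section \<open>Words: a basis of the free algebra\<close>

text \<open>
  The word \<open>NW u x v w\<close> stands for the product \<open>(u \<succ> (x v)) \<prec> w\<close>, where juxtaposition is the
  associative product. Its middle factor \<open>x v\<close> is never empty, which the
  distinguished letter \<open>x\<close> enforces.
\<close>

datatype 'x nword = NW "'x list" 'x "'x list" "'x list"

text \<open>
  The zero of the products is \<open>None\<close>. Each operation only ever lengthens one end of a block: a
  nonempty \<open>u\<close> or \<open>w\<close> that would end up inside another block makes the product vanish, and
  this is what the six vanishing relations say.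
\<close>

fun word_op :: "bgop \<Rightarrow> 'x nword option \<Rightarrow> 'x nword option \<Rightarrow> 'x nword option" where
  "word_op Mul (Some (NW u x v w)) (Some (NW u' x' v' w')) =
     (if w = [] \<and> u' = [] then Some (NW u x (v @ x' # v') w') else None)"
| "word_op Succ (Some (NW u x v w)) (Some (NW u' x' v' w')) =
     (if u = [] \<and> w = [] then Some (NW (x # v @ u') x' v' w') else None)"
| "word_op Prec (Some (NW u x v w)) (Some (NW u' x' v' w')) =
     (if u' = [] \<and> w' = [] then Some (NW u x v (w @ x' # v')) else None)"
| "word_op p None Y = None"
| "word_op p X None = None"

lemma word_op_None_right [simp]: "word_op p X None = None"
  by (cases X) auto

lemma word_op_identities: "bgdual_identities word_op None UNIV"
proof -
  have "(\<forall>(p, q, r, s)\<in>assoc_ops. word_op q (word_op p X Y) Z = word_op r X (word_op s Y Z)) \<and>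
     (\<forall>(p, q)\<in>left_zero_ops. word_op q (word_op p X Y) Z = None) \<and>
     (\<forall>(p, q)\<in>right_zero_ops. word_op p X (word_op q Y Z) = None)" for X Y Z :: "'a nword option"
  proof (cases "X = None \<or> Y = None \<or> Z = None")
    case False
    then obtain u x v w u' x' v' w' u'' x'' v'' w'' where
      "X = Some (NW u x v w)" "Y = Some (NW u' x' v' w')" "Z = Some (NW u'' x'' v'' w'')"
      by (metis nword.exhaust not_None_eq)
    then show ?thesis
      unfolding assoc_ops_def left_zero_ops_def right_zero_ops_def by auto
  qed auto
  then show ?thesis unfolding bgdual_identities_def by blast
qed

fun letters :: "'x nword \<Rightarrow> 'x list" where
  "letters (NW u x v w) = u @ x # v @ w"

lemma letters_word_op: "word_op p (Some T) (Some T') = Some T'' \<Longrightarrow> letters T'' = letters T @ letters T'"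
  by (cases T; cases T'; cases p) (auto split: if_splits)

fun tree_eval :: "(bgop \<Rightarrow> 'a \<Rightarrow> 'a \<Rightarrow> 'a) \<Rightarrow> ('x \<Rightarrow> 'a) \<Rightarrow> 'x optree \<Rightarrow> 'a" where
  "tree_eval m h (Leaf x) = h x"
| "tree_eval m h (Node p s t) = m p (tree_eval m h s) (tree_eval m h t)"

abbreviation letter :: "'x \<Rightarrow> 'x nword option" where
  "letter x \<equiv> Some (NW [] x [] [])"

abbreviation tree_word :: "'x optree \<Rightarrow> 'x nword option" where
  "tree_word \<equiv> tree_eval word_op letter"

lemma tree_word_letters: "tree_word t = Some T \<Longrightarrow> letters T = leaves t"
proof (induction t arbitrary: T)
  case (Node p s t)
  then obtain S S' where "tree_word s = Some S" "tree_word t = Some S'"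
    by (cases "tree_word s"; cases "tree_word t") auto
  with Node show ?case by (auto dest: letters_word_op)
qed auto

definition attach :: "bgop \<Rightarrow> 'x optree \<Rightarrow> 'x list \<Rightarrow> 'x optree" where
  "attach p = foldl (\<lambda>t j. Node p t (Leaf j))"

text \<open>
  The left comb whose value is the given word. Without letters in \<open>u\<close> there is no vertex
  \<open>Succ\<close>, so that \<open>x\<close> itself is the leftmost leaf.
\<close>

fun word_comb :: "'x nword \<Rightarrow> 'x optree" where
  "word_comb (NW u x v w) = attach Prec (attach Mul
     (case u of [] \<Rightarrow> Leaf x | y # ys \<Rightarrow> Node Succ (attach Mul (Leaf y) ys) (Leaf x)) v) w"

lemma leaves_attach: "leaves (attach p t xs) = leaves t @ xs"
  unfolding attach_def by (induction xs arbitrary: t) auto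

lemma leaves_word_comb: "leaves (word_comb T) = letters T"
  by (cases T) (auto simp: leaves_attach split: list.splits)

lemma tree_word_attach:
  "tree_word (attach Mul t xs) = foldl (\<lambda>X j. word_op Mul X (letter j)) (tree_word t) xs"
  "tree_word (attach Prec t xs) = foldl (\<lambda>X j. word_op Prec X (letter j)) (tree_word t) xs"
  unfolding attach_def by (induction xs arbitrary: t) auto

lemma foldl_word_op_Mul:
  "foldl (\<lambda>X j. word_op Mul X (letter j)) (Some (NW u x v [])) xs = Some (NW u x (v @ xs) [])"
  by (induction xs arbitrary: v) auto

lemma foldl_word_op_Prec:
  "foldl (\<lambda>X j. word_op Prec X (letter j)) (Some (NW u x v w)) xs = Some (NW u x v (w @ xs))"
  by (induction xs arbitrary: w) auto

lemma tree_word_comb: "tree_word (word_comb T) = Some T"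
  by (cases T)
    (auto simp: tree_word_attach foldl_word_op_Mul foldl_word_op_Prec split: list.splits)

context bgdual_ops
begin

definition word_eval :: "('x \<Rightarrow> 'a) \<Rightarrow> 'x nword option \<Rightarrow> 'a" where
  "word_eval h X = (case X of None \<Rightarrow> 0 | Some T \<Rightarrow> tree_eval opr h (word_comb T))"

abbreviation chain :: "bgop \<Rightarrow> ('x \<Rightarrow> 'a) \<Rightarrow> 'a \<Rightarrow> 'x list \<Rightarrow> 'a" where
  "chain p h \<equiv> foldl (\<lambda>a j. opr p a (h j))"

lemma tree_eval_attach: "tree_eval opr h (attach p t xs) = chain p h (tree_eval opr h t) xs"
  unfolding attach_def by (induction xs arbitrary: t) auto

lemma chain_assoc:
  assumes "(q, p, q, p) \<in> assoc_ops"
  shows "opr q a (chain p h b xs) = chain p h (opr q a b) xs"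
  using opr_assoc[OF assms] by (induction xs arbitrary: b) auto

lemma chain_move:
  "opr Mul a (chain Mul h b xs) = chain Mul h (opr Mul a b) xs"
  "opr Succ a (chain Mul h b xs) = chain Mul h (opr Succ a b) xs"
  "opr Mul a (chain Prec h b xs) = chain Prec h (opr Mul a b) xs"
  "opr Succ a (chain Prec h b xs) = chain Prec h (opr Succ a b) xs"
  by (rule chain_assoc; simp add: assoc_ops_def)+

text \<open>The relation \<open>(a \<prec> b) \<prec> c = a \<prec> (b \<ast> c)\<close> turns a chain of products into one of \<open>\<prec>\<close>.\<close>

lemma chain_Prec_absorb: "opr Prec a (chain Mul h b xs) = chain Prec h (opr Prec a b) xs"
proof (induction xs arbitrary: b)
  case (Cons x xs)
  show ?case
    using Cons[of "opr Mul b (h x)"] opr_assoc[of Prec Prec Prec Mul a b "h x"]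
    by (simp add: assoc_ops_def)
qed simp

lemma chain_last: "xs \<noteq> [] \<Longrightarrow> \<exists>b c. chain p h a xs = opr p b c"
  by (cases xs rule: rev_cases) auto

text \<open>
  The factor \<open>u \<succ> x\<close> of a word. The value of the whole word arises from it by a chain of
  products with the letters of \<open>v\<close> and a chain of operations \<open>\<prec>\<close> with those of \<open>w\<close>, so words
  are multiplied by moving a factor through chains.
\<close>

definition left_block :: "('x \<Rightarrow> 'a) \<Rightarrow> 'x list \<Rightarrow> 'x \<Rightarrow> 'a" where
  "left_block h u x = (case u of [] \<Rightarrow> h x | y # ys \<Rightarrow> opr Succ (chain Mul h (h y) ys) (h x))"

lemma word_eval_NW:
  "word_eval h (Some (NW u x v w)) = chain Prec h (chain Mul h (left_block h u x) v) w"
  by (cases u) (simp_all add: word_eval_def left_block_def tree_eval_attach)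

lemma word_eval_None [simp]: "word_eval h None = 0"
  by (simp add: word_eval_def)

lemma word_eval_letter [simp]: "word_eval h (letter x) = h x"
  by (simp add: word_eval_NW left_block_def)

text \<open>The \<open>\<succ>\<close> of a word can be performed last, although the comb performs it early.\<close>

lemma word_eval_left:
  assumes "u \<noteq> []" shows "\<exists>b c. word_eval h (Some (NW u x v w)) = opr Succ b c"
proof -
  obtain y ys where u: "u = y # ys" using assms by (cases u) auto
  have "word_eval h (Some (NW u x v w)) =
      opr Succ (chain Mul h (h y) ys) (chain Prec h (chain Mul h (h x) v) w)"
    by (simp add: word_eval_NW left_block_def u chain_move)
  then show ?thesis by blast
qed

lemma word_eval_right:
  assumes "w \<noteq> []" shows "\<exists>b c. word_eval h (Some (NW u x v w)) = opr Prec b c"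
  using chain_last[OF assms] by (simp add: word_eval_NW)

text \<open>
  The formal product is the actual one in every algebra: the associativity relations move the
  left factor through the chains of the right one, and a vanishing relation applies as soon as a
  nonempty \<open>u\<close> exhibits the factor as some \<open>b \<succ> c\<close>, or a nonempty \<open>w\<close> as some \<open>b \<prec> c\<close>,
  on a side where no such element may stand. By induction every tree reduces to a comb or to zero.
\<close>

lemma word_eval_op: "opr p (word_eval h X) (word_eval h Y) = word_eval h (word_op p X Y)"
proof (cases "X = None \<or> Y = None")
  case False
  then obtain u x v w u' x' v' w' where
    X: "X = Some (NW u x v w)" and Y: "Y = Some (NW u' x' v' w')"
    by (metis nword.exhaust not_None_eq)
  note zeros = opr_left_zero[unfolded left_zero_ops_def] opr_right_zero[unfolded right_zero_ops_def]
  show ?thesis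
  proof (cases p)
    case Mul
    consider "w \<noteq> []" | "u' \<noteq> []" | "w = []" "u' = []" by blast
    then show ?thesis
    proof cases
      case 1
      then show ?thesis using word_eval_right[OF 1, of h u x v] zeros by (auto simp: X Y Mul)
    next
      case 2
      then show ?thesis using word_eval_left[OF 2, of h x' v' w'] zeros by (auto simp: X Y Mul)
    next
      case 3
      then show ?thesis by (simp add: X Y Mul word_eval_NW chain_move left_block_def)
    qed
  next
    case Succ
    consider "u \<noteq> []" | "w \<noteq> []" | "u = []" "w = []" by blast
    then show ?thesis
    proof cases
      case 1
      then show ?thesis using word_eval_left[OF 1, of h x v w] zeros by (auto simp: X Y Succ)
    next
      case 2
      then show ?thesis using word_eval_right[OF 2, of h u x v] zeros by (auto simp: X Y Succ)
    next
      case 3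
      have "opr Succ (chain Mul h (h x) v) (left_block h u' x') = left_block h (x # v @ u') x'"
        using opr_assoc[of Mul Succ Succ Succ]
        by (cases u') (simp_all add: left_block_def assoc_ops_def flip: chain_move)
      with 3 show ?thesis
        by (simp add: X Y Succ word_eval_NW chain_move) (simp add: left_block_def)
    qed
  next
    case Prec
    consider "u' \<noteq> []" | "w' \<noteq> []" | "u' = []" "w' = []" by blast
    then show ?thesis
    proof cases
      case 1
      then show ?thesis using word_eval_left[OF 1, of h x' v' w'] zeros by (auto simp: X Y Prec)
    next
      case 2
      then show ?thesis using word_eval_right[OF 2, of h u' x' v'] zeros by (auto simp: X Y Prec)
    next
      case 3
      then show ?thesis
        by (simp add: X Y Prec word_eval_NW chain_Prec_absorb left_block_def)
    qed
  qed
qed auto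

lemma tree_eval_word: "tree_eval opr h t = word_eval h (tree_word t)"
  by (induction t) (simp_all add: word_eval_op)

end

text \<open>
  A bilinear algebra spanned by a family that multiplies like words satisfies the relations,
  because words do.
\<close>

locale word_model = bilinear_ops scale opr
  for scale :: "'k::field \<Rightarrow> 'a::ab_group_add \<Rightarrow> 'a" and opr :: "bgop \<Rightarrow> 'a \<Rightarrow> 'a \<Rightarrow> 'a" +
  fixes b :: "'x nword option \<Rightarrow> 'a"
  assumes b_None: "b None = 0"
    and b_op: "\<And>p X Y. opr p (b X) (b Y) = b (word_op p X Y)"
    and span_b: "span (range b) = UNIV"
begin

lemma tree_eval_model: "tree_eval opr (\<lambda>x. b (letter x)) t = b (tree_word t)"
  by (induction t) (simp_all add: b_op)

sublocale bgdual_ops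
proof
  note id = bgdual_identitiesD[OF word_op_identities UNIV_I UNIV_I UNIV_I]
  have "opr q (opr p (b X) (b Y)) (b Z) = opr r (b X) (opr s (b Y) (b Z))"
    if "(p, q, r, s) \<in> assoc_ops" for p q r s X Y Z
    by (simp only: b_op id(1)[OF that])
  moreover have "opr q (opr p (b X) (b Y)) (b Z) = 0" if "(p, q) \<in> left_zero_ops" for p q X Y Z
    by (simp only: b_op id(2)[OF that] b_None)
  moreover have "opr p (b X) (opr q (b Y) (b Z)) = 0" if "(p, q) \<in> right_zero_ops" for p q X Y Z
    by (simp only: b_op id(3)[OF that] b_None)
  ultimately have "bgdual_identities opr 0 (range b)"
    unfolding bgdual_identities_def by blast
  then show "bgdual_identities opr 0 UNIV" by (rule identities_from_spanning[OF span_b])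
qed

end


section \<open>Forests as words in one letter\<close>

abbreviation leaf_trees :: "'x list \<Rightarrow> dtree list" where
  "leaf_trees xs \<equiv> map (\<lambda>_. B [] []) xs"

text \<open>
  The forest of a word \<open>(u \<succ> (x v)) \<prec> w\<close> in which every letter is replaced by \<open>\<bullet>\<close>: the
  letters of \<open>x v\<close> are its roots, those of \<open>u\<close> hang on the first root and those of \<open>w\<close> on the
  last one.
\<close>

fun word_trees :: "'x nword \<Rightarrow> dtree list" where
  "word_trees (NW u x v w) = prec_trees (B (leaf_trees u) [] # leaf_trees v) (leaf_trees w)"

lemma word_trees_simps:
  "word_trees (NW u x [] w) = [B (leaf_trees u) (leaf_trees w)]"
  "word_trees (NW u x (v @ [y]) w) = B (leaf_trees u) [] # leaf_trees v @ [B [] (leaf_trees w)]"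
  using prec_trees_snoc[of "B (leaf_trees u) [] # leaf_trees v" "[]" "[]" "leaf_trees w"] by simp_all

lemma nword_cases:
  obtains (single) u x w where "T = NW u x [] w" | (several) u x v y w where "T = NW u x (v @ [y]) w"
  by (metis nword.exhaust rev_exhaust)

fun l_subtrees :: "dtree \<Rightarrow> dtree list" where "l_subtrees (B F G) = F"
fun r_subtrees :: "dtree \<Rightarrow> dtree list" where "r_subtrees (B F G) = G"

abbreviation units :: "'x list \<Rightarrow> unit list" where
  "units xs \<equiv> map (\<lambda>_. ()) xs"

text \<open>
  With one letter only, a word is determined by the lengths of its lists, and these are read off
  from the number of roots and the children of the first and of the last root.
\<close>

definition trees_word :: "dtree list \<Rightarrow> unit nword" where
  "trees_word F = NW (units (l_subtrees (hd F))) () (units (tl F)) (units (r_subtrees (last F)))"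

lemma units_unit [simp]: "units (xs :: unit list) = xs"
  by (induction xs) auto

lemma trees_word_of_word: "trees_word (word_trees T) = T"
proof (cases T rule: nword_cases)
  case (several u x v y w)
  then show ?thesis by (simp only: word_trees_simps trees_word_def) (simp add: comp_def)
qed (simp add: trees_word_def comp_def)

lemma dual_word_trees: "dual_trees (word_trees T)"
proof (cases T rule: nword_cases)
  case (single u x w)
  then show ?thesis by (auto simp: dual_trees_iff corolla_B)
next
  case (several u x v y w)
  then show ?thesis
    by (simp only: word_trees_simps) (auto simp: dual_trees_iff corolla_B butlast_append)
qed

lemma word_trees_not_Nil: "word_trees T \<noteq> []"
  by (cases T) (simp add: prec_trees_eq_Nil)

lemma leaf_trees_units: "(\<And>T. T \<in> set F \<Longrightarrow> T = B [] []) \<Longrightarrow> leaf_trees (units F) = F"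
  by (induction F) auto

text \<open>
  In a forest of \<open>\<F>\<^sup>!\<close> a root that is neither the first nor the last has no edges at all, and
  the children of the others are leaves; so only the number of these children is free.
\<close>

lemma word_of_trees_word:
  assumes "dual_trees F" "F \<noteq> []"
  shows "word_trees (trees_word F) = F"
proof -
  obtain a b Fs where F: "F = B a b # Fs" using assms(2) by (metis dtree.exhaust list.exhaust)
  show ?thesis
  proof (cases Fs rule: rev_cases)
    case Nil
    then show ?thesis
      using assms(1) by (auto simp: F dual_trees_iff corolla_B trees_word_def leaf_trees_units
            simp del: map_map)
  next
    case (snoc Gs T)
    obtain c d where T: "T = B c d" by (cases T)
    have *: "leaf_trees (units Gs) = Gs"
    proof (rule leaf_trees_units)
      fix S assume "S \<in> set Gs"
      then have "\<not> has_l_edge S" "\<not> has_r_edge S"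
        using assms(1) by (auto simp: F snoc dual_trees_iff butlast_append)
      then show "S = B [] []" by (cases S) auto
    qed
    have "b = []" "c = []" "leaf_trees (units a) = a" "leaf_trees (units d) = d"
      using assms(1)
      by (auto simp: F snoc T dual_trees_iff corolla_B butlast_append simp del: map_map
          intro!: leaf_trees_units)
    then show ?thesis using * word_trees_simps(2)[of "units a" "()" "units Gs" "()" "units d"]
      by (simp add: F snoc T trees_word_def del: map_map)
  qed
qed

fun trees_op :: "bgop \<Rightarrow> dtree list \<Rightarrow> dtree list \<Rightarrow> dtree list" where
  "trees_op Mul = (@)" | "trees_op Succ = succ_trees" | "trees_op Prec = prec_trees"

lemma prec_trees_append:
  assumes "ys \<noteq> []" shows "prec_trees (xs @ ys) F = xs @ prec_trees ys F"
proof -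
  obtain Ts a b where "ys = Ts @ [B a b]" using assms by (metis dtree.exhaust rev_exhaust)
  then show ?thesis using prec_trees_snoc[of "xs @ Ts" a b F] by (simp add: prec_trees_snoc)
qed

lemma prec_trees_prec_trees: "prec_trees (prec_trees G F) F' = prec_trees G (F @ F')"
proof (cases G rule: rev_cases)
  case (snoc Ts T)
  then show ?thesis by (cases T) (simp add: prec_trees_snoc)
qed simp

lemma prec_trees_Nil: "prec_trees G [] = G"
proof (cases G rule: rev_cases)
  case (snoc Ts T)
  then show ?thesis by (cases T) (simp add: prec_trees_snoc)
qed simp

lemma succ_trees_prec_trees:
  assumes "F \<noteq> []" shows "succ_trees G (prec_trees F H) = prec_trees (succ_trees G F) H"
proof -
  obtain a b Fs where "F = B a b # Fs" using assms by (metis dtree.exhaust list.exhaust)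
  then show ?thesis by (cases Fs) simp_all
qed

lemma trees_op_words:
  assumes "word_op p (Some T) (Some T') = Some T''"
  shows "trees_op p (word_trees T) (word_trees T') = word_trees T''"
proof -
  obtain u x v w u' x' v' w' where T: "T = NW u x v w" "T' = NW u' x' v' w'"
    by (metis nword.exhaust)
  show ?thesis
  proof (cases p)
    case Mul
    then show ?thesis using assms
        prec_trees_append[of "B [] [] # leaf_trees v'" "B (leaf_trees u) [] # leaf_trees v"]
      by (auto simp: T prec_trees_Nil split: if_splits)
  next
    case Succ
    then show ?thesis using assms
      by (auto simp: T prec_trees_Nil succ_trees_prec_trees split: if_splits)
  next
    case Prec
    then show ?thesis using assms
      by (auto simp: T prec_trees_Nil prec_trees_prec_trees split: if_splits)
  qed
qed

lemma word_trees_edges: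
  "u \<noteq> [] \<Longrightarrow> has_l_edge (hd (word_trees (NW u x v w)))"
  "w \<noteq> [] \<Longrightarrow> has_r_edge (last (word_trees (NW u x v w)))"
proof -
  show "u \<noteq> [] \<Longrightarrow> has_l_edge (hd (word_trees (NW u x v w)))"
    by (cases v rule: rev_cases) (simp_all only: word_trees_simps, simp_all)
  show "w \<noteq> [] \<Longrightarrow> has_r_edge (last (word_trees (NW u x v w)))"
    by (cases v rule: rev_cases) (simp_all only: word_trees_simps, simp_all)
qed

text \<open>The trees grafted by \<open>\<succ>\<close> and \<open>\<prec>\<close> become subtrees of a root, which must stay a corolla.\<close>

lemma dual_trees_grafted:
  shows "dual_trees (succ_trees G F) \<Longrightarrow> F \<noteq> [] \<Longrightarrow> T \<in> set G \<Longrightarrow> T = B [] []"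
    and "dual_trees (prec_trees F G) \<Longrightarrow> F \<noteq> [] \<Longrightarrow> T \<in> set G \<Longrightarrow> T = B [] []"
proof -
  assume "dual_trees (succ_trees G F)" "F \<noteq> []" "T \<in> set G"
  then show "T = B [] []"
    by (cases "(G, F)" rule: succ_trees.cases) (auto simp: dual_trees_iff corolla_B)
next
  assume *: "dual_trees (prec_trees F G)" "F \<noteq> []" "T \<in> set G"
  obtain a b Ts where "F = Ts @ [B a b]" using *(2) by (metis dtree.exhaust rev_exhaust)
  then show "T = B [] []"
    using * by (auto simp: prec_trees_snoc dual_trees_iff corolla_B)
qed

text \<open>
  If the product of words vanishes, a factor has an edge where \<open>\<F>\<^sup>!\<close> does not allow one:
  concatenation moves it away from the ends of the forest, and grafting raises it to
  distance \<open>2\<close> from the root.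
\<close>

lemma trees_op_not_dual:
  assumes "word_op p (Some T) (Some T') = None"
  shows "\<not> dual_trees (trees_op p (word_trees T) (word_trees T'))"
proof -
  obtain u x v w u' x' v' w' where T: "T = NW u x v w" "T' = NW u' x' v' w'"
    by (metis nword.exhaust)
  note ne = word_trees_not_Nil[of T] word_trees_not_Nil[of T']
  have edges: "u \<noteq> [] \<Longrightarrow> has_l_edge (hd (word_trees T))" "w \<noteq> [] \<Longrightarrow> has_r_edge (last (word_trees T))"
    "u' \<noteq> [] \<Longrightarrow> has_l_edge (hd (word_trees T'))" "w' \<noteq> [] \<Longrightarrow> has_r_edge (last (word_trees T'))"
    unfolding T by (rule word_trees_edges; assumption)+
  have edge: "has_l_edge S \<or> has_r_edge S \<Longrightarrow> S \<noteq> B [] []" for S by auto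
  show ?thesis
  proof (cases p)
    case Mul
    then have "w \<noteq> [] \<or> u' \<noteq> []" using assms by (auto simp: T split: if_splits)
    then have "has_r_edge (last (word_trees T)) \<or> has_l_edge (hd (word_trees T'))"
      using edges by blast
    moreover have "last (word_trees T) \<in> set (butlast (word_trees T @ word_trees T'))"
      using ne by (simp add: butlast_append)
    moreover have "hd (word_trees T') \<in> set (tl (word_trees T @ word_trees T'))"
      using ne by simp
    ultimately show ?thesis unfolding Mul trees_op.simps dual_trees_iff by blast
  next
    case Succ
    then have "u \<noteq> [] \<or> w \<noteq> []" using assms by (auto simp: T split: if_splits)
    then have "has_l_edge (hd (word_trees T)) \<or> has_r_edge (last (word_trees T))"
      using edges by blast
    then show ?thesis
      using dual_trees_grafted(1)[OF _ ne(2), of "word_trees T"] edge ne(1)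
      unfolding Succ trees_op.simps by (metis hd_in_set last_in_set)
  next
    case Prec
    then have "u' \<noteq> [] \<or> w' \<noteq> []" using assms by (auto simp: T split: if_splits)
    then have "has_l_edge (hd (word_trees T')) \<or> has_r_edge (last (word_trees T'))"
      using edges by blast
    then show ?thesis
      using dual_trees_grafted(2)[OF _ ne(1), of "word_trees T'"] edge ne(2)
      unfolding Prec trees_op.simps by (metis hd_in_set last_in_set)
  qed
qed

section \<open>The quotient algebra of forests is free on the one-vertex tree\<close>

definition word_forest :: "'x nword \<Rightarrow> forest" where
  "word_forest T = Forest (word_trees T)"

definition forest_word :: "forest \<Rightarrow> unit nword option" where
  "forest_word F = (if dual_forest F then Some (trees_word (trees_of F)) else None)"

fun forest_op :: "bgop \<Rightarrow> forest \<Rightarrow> forest \<Rightarrow> forest" where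
  "forest_op Mul = fcat" | "forest_op Succ = fsucc" | "forest_op Prec = fprec"

lemma trees_of_forest_op: "trees_of (forest_op p F G) = trees_op p (trees_of F) (trees_of G)"
  by (cases p) (simp_all add: fcat.rep_eq fsucc.rep_eq fprec.rep_eq)

lemma trees_of_word_forest: "trees_of (word_forest T) = word_trees T"
  by (simp add: word_forest_def Forest_inverse word_trees_not_Nil)

lemma forest_word_of_word [simp]: "forest_word (word_forest T) = Some T"
  by (simp add: forest_word_def dual_forest.rep_eq trees_of_word_forest dual_word_trees
      trees_word_of_word)

lemma forest_word_Some: "forest_word F = Some T \<longleftrightarrow> F = word_forest T"
proof
  assume "forest_word F = Some T"
  then have "dual_trees (trees_of F)" "T = trees_word (trees_of F)"
    by (auto simp: forest_word_def dual_forest.rep_eq split: if_splits)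
  then have "trees_of F = word_trees T"
    using word_of_trees_word trees_of by force
  then show "F = word_forest T" by (metis word_forest_def trees_of_inverse)
qed simp

lemma forest_word_None: "forest_word F = None \<longleftrightarrow> \<not> dual_forest F"
  by (simp add: forest_word_def)

lemma preserves_nondual_forest_op: "preserves_nondual (forest_op p)"
  by (cases p) (simp_all add: preserves_nondual_fcat preserves_nondual_fsucc preserves_nondual_fprec)

text \<open>
  A factor outside \<open>\<F>\<^sup>!\<close> makes the product lie outside, just as a zero factor makes it vanish;
  the forests in \<open>\<F>\<^sup>!\<close> multiply as \<open>trees_op_words\<close> and \<open>trees_op_not_dual\<close> tell.
\<close>

lemma forest_word_op:
  "forest_word (forest_op p F G) = word_op p (forest_word F) (forest_word G)"
proof (cases "dual_forest F \<and> dual_forest G")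
  case False
  then have "\<not> dual_forest (forest_op p F G)"
    using preserves_nondual_forest_op unfolding preserves_nondual_def by blast
  then show ?thesis using False by (auto simp: forest_word_def)
next
  case True
  then obtain T T' where "forest_word F = Some T" "forest_word G = Some T'"
    by (simp add: forest_word_def)
  then have FG: "F = word_forest T" "G = word_forest T'" by (simp_all add: forest_word_Some)
  show ?thesis
  proof (cases "word_op p (Some T) (Some T')")
    case None
    then have "forest_word (forest_op p F G) = None"
      using trees_op_not_dual[OF None]
      by (simp add: forest_word_None FG dual_forest.rep_eq trees_of_forest_op trees_of_word_forest)
    then show ?thesis by (simp add: None FG)
  next
    case (Some T'')
    then have "forest_op p F G = word_forest T''"
      using trees_op_words[OF Some]
      by (simp add: FG trees_of_forest_op trees_of_word_forest flip: trees_of_inject)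
    then show ?thesis by (simp add: Some FG)
  qed
qed

abbreviation dfa_opr :: "bgop \<Rightarrow> 'k::field dual_forest_alg \<Rightarrow> 'k dual_forest_alg \<Rightarrow> 'k dual_forest_alg" where
  "dfa_opr \<equiv> bg_opr dfa_mul dfa_succ dfa_prec"

lemma dfa_opr_class: "dfa_opr p (dfa_class f) (dfa_class g) = dfa_class (bilin_ext (forest_op p) f g)"
  by (cases p) (simp_all add: dfa_mul.abs_eq dfa_succ.abs_eq dfa_prec.abs_eq)

definition dfa_word :: "unit nword option \<Rightarrow> 'k::field dual_forest_alg" where
  "dfa_word X = (case X of None \<Rightarrow> 0 | Some T \<Rightarrow> dfa_class (basis_vec (word_forest T)))"

text \<open>A forest outside \<open>\<F>\<^sup>!\<close> belongs to the ideal.\<close>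

lemma dfa_class_forest: "dfa_class (basis_vec F) = dfa_word (forest_word F)"
proof (cases "forest_word F")
  case None
  then have "basis_vec F \<in> forest_ideal"
    by (simp add: forest_ideal_iff forest_word_None)
  then show ?thesis
    by (simp add: dfa_word_def None zero_dual_forest_alg.abs_eq dual_forest_alg.abs_eq_iff)
next
  case (Some T)
  then show ?thesis by (simp add: dfa_word_def forest_word_Some)
qed

lemma linear_dfa_class: "Vector_Spaces.linear pscale dfa_scale dfa_class"
  by (simp add: Vector_Spaces.linear_iff plus_dual_forest_alg.abs_eq dfa_scale.abs_eq
      pv.vector_space_axioms dfa.vector_space_axioms)

lemma surj_dfa_class: "surj dfa_class"
  by (rule surjI[of _ dfa_rep]) (rule Quotient3_abs_rep[OF Quotient3_dual_forest_alg])

lemma span_dfa_words: "dfa.span (range dfa_word) = UNIV"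
proof -
  interpret c: Vector_Spaces.linear pscale dfa_scale "dfa_class :: _ \<Rightarrow> 'a dual_forest_alg"
    by (rule linear_dfa_class)
  have "(UNIV :: 'a dual_forest_alg set) = dfa_class ` pv.span (range basis_vec)"
    by (simp add: span_basis_vecs surj_dfa_class)
  also have "\<dots> = dfa.span (dfa_class ` range basis_vec)" by (rule c.span_image[symmetric])
  also have "\<dots> \<subseteq> dfa.span (range dfa_word)"
    by (intro dfa.span_mono) (auto simp: dfa_class_forest)
  finally show ?thesis by auto
qed

lemma bilinear_dfa_opr: "bilinear_ops dfa_scale dfa_opr"
proof (intro bilinear_ops.intro bilinear_ops_axioms.intro dfa.vector_space_axioms)
  note simps = dfa_opr_class bilin_ext_add_left bilin_ext_add_right bilin_ext_scale_left
    bilin_ext_scale_right plus_dual_forest_alg.abs_eq dfa_scale.abs_eq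
  show "Vector_Spaces.linear dfa_scale dfa_scale (\<lambda>X. dfa_opr p X Y)"
    for p and Y :: "'a dual_forest_alg"
  proof -
    have "dfa_opr p (X + X') Y = dfa_opr p X Y + dfa_opr p X' Y"
      "dfa_opr p (dfa_scale c X) Y = dfa_scale c (dfa_opr p X Y)" for X X' c
      by (induct X rule: dual_forest_alg.abs_induct; induct X' rule: dual_forest_alg.abs_induct;
          induct Y rule: dual_forest_alg.abs_induct; simp add: simps)+
    then show ?thesis by (simp add: Vector_Spaces.linear_iff dfa.vector_space_axioms)
  qed
  show "Vector_Spaces.linear dfa_scale dfa_scale (dfa_opr p X)"
    for p and X :: "'a dual_forest_alg"
  proof -
    have "dfa_opr p X (Y + Y') = dfa_opr p X Y + dfa_opr p X Y'"
      "dfa_opr p X (dfa_scale c Y) = dfa_scale c (dfa_opr p X Y)" for Y Y' c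
      by (induct X rule: dual_forest_alg.abs_induct; induct Y rule: dual_forest_alg.abs_induct;
          induct Y' rule: dual_forest_alg.abs_induct; simp add: simps)+
    then show ?thesis by (simp add: Vector_Spaces.linear_iff dfa.vector_space_axioms)
  qed
qed

interpretation dfa: word_model dfa_scale dfa_opr dfa_word
proof -
  interpret bilinear_ops dfa_scale "dfa_opr :: bgop \<Rightarrow> 'a dual_forest_alg \<Rightarrow> _"
    by (rule bilinear_dfa_opr)
  show "word_model dfa_scale (dfa_opr :: bgop \<Rightarrow> 'a dual_forest_alg \<Rightarrow> _) dfa_word"
  proof
    show None: "dfa_word None = (0 :: 'a dual_forest_alg)" by (simp add: dfa_word_def)
    show "dfa_opr p (dfa_word X) (dfa_word Y :: 'a dual_forest_alg) = dfa_word (word_op p X Y)"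
      for p X Y
    proof (cases "X = None \<or> Y = None")
      case False
      then obtain T T' where XY: "X = Some T" "Y = Some T'" by (cases X; cases Y) auto
      have "dfa_opr p (dfa_word X) (dfa_word Y :: 'a dual_forest_alg) =
          dfa_class (basis_vec (forest_op p (word_forest T) (word_forest T')))"
        by (simp add: dfa_word_def XY dfa_opr_class)
      then show ?thesis by (simp add: dfa_class_forest forest_word_op XY)
    qed (auto simp: None)
    show "dfa.span (range dfa_word) = (UNIV :: 'a dual_forest_alg set)" by (rule span_dfa_words)
  qed
qed

theorem bgdual_algebra_dfa: "bgdual_algebra dfa_scale dfa_mul dfa_succ dfa_prec"
  unfolding bgdual_algebra_iff_ops by (rule dfa.bgdual_ops_axioms)

lemma dfa_bullet_word: "dfa_bullet = dfa_word (letter ())"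
proof -
  have "bullet = word_forest (NW [] () [] [])"
    by (simp add: bullet_def word_forest_def)
  then show ?thesis by (simp add: dfa_word_def dfa_bullet.abs_eq)
qed

text \<open>
  The morphism evaluates the word of a forest at \<open>a\<close>. It kills the ideal, whose forests have no
  word, and it is multiplicative because words multiply in the target as in \<open>\<M>\<^sup>!\<close>.
\<close>

theorem dfa_free_hom:
  fixes scale :: "'k::field \<Rightarrow> 'a::ab_group_add \<Rightarrow> 'a"
  assumes "bgdual_algebra scale mul succ prec"
  shows "\<exists>\<phi>. bgdual_hom dfa_scale dfa_mul dfa_succ dfa_prec scale mul succ prec \<phi> \<and>
           \<phi> dfa_bullet = a"
proof -
  interpret A: bgdual_algebra scale mul succ prec by fact
  interpret A: bgdual_ops scale "bg_opr mul succ prec"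
    using assms unfolding bgdual_algebra_iff_ops .
  define g where "g F = A.word_eval (\<lambda>_. a) (forest_word F)" for F
  define \<phi> where "\<phi> X = vec_ext scale g (dfa_rep X)" for X
  have ideal: "vec_ext scale g f = 0" if "f \<in> forest_ideal" for f
    using that unfolding vec_ext_def forest_ideal_iff
    by (intro sum.neutral) (auto simp: g_def forest_word_def)
  have \<phi>_class: "\<phi> (dfa_class f) = vec_ext scale g f" for f
  proof -
    have "dfa_rep (dfa_class f) - f \<in> forest_ideal"
      using Quotient3_abs_rep[OF Quotient3_dual_forest_alg] by (metis dual_forest_alg.abs_eq_iff)
    from ideal[OF this] show ?thesis by (simp add: \<phi>_def A.vec_ext_diff)
  qed
  have lin: "Vector_Spaces.linear dfa_scale scale \<phi>"
  proof -
    have "\<phi> (X + Y) = \<phi> X + \<phi> Y" "\<phi> (dfa_scale c X) = scale c (\<phi> X)" for X Y c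
      by (induct X rule: dual_forest_alg.abs_induct; induct Y rule: dual_forest_alg.abs_induct;
          simp add: \<phi>_class plus_dual_forest_alg.abs_eq dfa_scale.abs_eq A.vec_ext_add A.vec_ext_scale)+
    then show ?thesis
      by (simp add: Vector_Spaces.linear_iff dfa.vector_space_axioms A.vector_space_axioms)
  qed
  have \<phi>_word: "\<phi> (dfa_word X) = A.word_eval (\<lambda>_. a) X" for X
  proof (cases X)
    case None
    have "\<phi> (dfa_class 0) = 0" by (simp add: \<phi>_class)
    then show ?thesis by (simp add: dfa_word_def None zero_dual_forest_alg.abs_eq)
  next
    case (Some T)
    then show ?thesis by (simp add: dfa_word_def \<phi>_class g_def)
  qed
  have hom: "\<phi> (dfa_opr p X Y) = bg_opr mul succ prec p (\<phi> X) (\<phi> Y)" for p X Y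
  proof -
    note simps = Vector_Spaces.linear_iff dfa.vector_space_axioms A.vector_space_axioms
      dfa.opr_add_left dfa.opr_add_right dfa.opr_scale_left dfa.opr_scale_right
      A.opr_add_left A.opr_add_right A.opr_scale_left A.opr_scale_right
      lin[unfolded Vector_Spaces.linear_iff]
    have 1: "\<phi> (dfa_opr p (dfa_word X) Y) = bg_opr mul succ prec p (\<phi> (dfa_word X)) (\<phi> Y)" for X Y
      by (rule linear_eq_on_spanning[OF _ _ dfa.span_b, where x = Y
            and f = "\<lambda>Y. \<phi> (dfa_opr p (dfa_word X) Y)"
            and g = "\<lambda>Y. bg_opr mul succ prec p (\<phi> (dfa_word X)) (\<phi> Y)"])
        (auto simp: simps dfa.b_op \<phi>_word A.word_eval_op)
    show ?thesis
      by (rule linear_eq_on_spanning[OF _ _ dfa.span_b, where x = X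
            and f = "\<lambda>X. \<phi> (dfa_opr p X Y)"
            and g = "\<lambda>X. bg_opr mul succ prec p (\<phi> X) (\<phi> Y)"])
        (auto simp: simps 1)
  qed
  have "bgdual_hom dfa_scale dfa_mul dfa_succ dfa_prec scale mul succ prec \<phi>"
    using hom[of Mul] hom[of Succ] hom[of Prec]
    by (intro bgdual_hom.intro bgdual_algebra_dfa assms lin bgdual_hom_axioms.intro) simp_all
  moreover have "\<phi> dfa_bullet = a" by (simp add: dfa_bullet_word \<phi>_word)
  ultimately show ?thesis by blast
qed

lemma bgdual_hom_tree_eval:
  assumes "bgdual_hom scale mul succ prec scale' mul' succ' prec' \<phi>"
  shows "\<phi> (tree_eval (bg_opr mul succ prec) h t) =
         tree_eval (bg_opr mul' succ' prec') (\<lambda>x. \<phi> (h x)) t"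
proof -
  interpret bgdual_hom scale mul succ prec scale' mul' succ' prec' \<phi> by fact
  have "\<phi> (bg_opr mul succ prec p x y) = bg_opr mul' succ' prec' p (\<phi> x) (\<phi> y)" for p x y
    by (cases p) (simp_all add: hom_mul hom_succ hom_prec)
  then show ?thesis by (induction t) simp_all
qed

text \<open>A forest of \<open>\<F>\<^sup>!\<close> is the value at \<open>\<bullet>\<close> of a comb, so \<open>\<bullet>\<close> generates \<open>\<M>\<^sup>!\<close>.\<close>

theorem dfa_hom_unique:
  fixes \<phi> \<psi> :: "'k::field dual_forest_alg \<Rightarrow> 'a::ab_group_add"
  assumes "bgdual_hom dfa_scale dfa_mul dfa_succ dfa_prec scale mul succ prec \<phi>"
    and "bgdual_hom dfa_scale dfa_mul dfa_succ dfa_prec scale mul succ prec \<psi>"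
    and "\<phi> dfa_bullet = \<psi> dfa_bullet"
  shows "\<phi> = \<psi>"
proof
  interpret \<phi>: bgdual_hom dfa_scale dfa_mul dfa_succ dfa_prec scale mul succ prec \<phi> by fact
  interpret \<psi>: bgdual_hom dfa_scale dfa_mul dfa_succ dfa_prec scale mul succ prec \<psi> by fact
  fix X
  have *: "\<phi> (dfa_word Y) = \<psi> (dfa_word Y)" for Y
  proof (cases Y)
    case None
    then show ?thesis by (simp add: dfa.b_None \<phi>.zero \<psi>.zero)
  next
    case (Some T)
    have "(dfa_word Y :: 'k dual_forest_alg) = tree_eval dfa_opr (\<lambda>x. dfa_word (letter x)) (word_comb T)"
      by (simp only: Some dfa.tree_eval_model tree_word_comb)
    also have "\<dots> = tree_eval dfa_opr (\<lambda>_. dfa_bullet) (word_comb T)"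
      by (simp add: dfa_bullet_word)
    finally have "(dfa_word Y :: 'k dual_forest_alg) = tree_eval dfa_opr (\<lambda>_. dfa_bullet) (word_comb T)" .
    then show ?thesis
      by (simp only: bgdual_hom_tree_eval[OF assms(1)] bgdual_hom_tree_eval[OF assms(2)] assms(3))
  qed
  show "\<phi> X = \<psi> X"
    by (rule linear_eq_on_spanning[OF \<phi>.linear_axioms \<psi>.linear_axioms dfa.span_b])
      (use * in auto)
qed


section \<open>Algebras over the operad\<close>

lemma tree_eval_map: "tree_eval m h (map_optree \<sigma> t) = tree_eval m (\<lambda>x. h (\<sigma> x)) t"
  by (induction t) auto

lemma tree_eval_cong:
  "(\<And>x. x \<in> set (leaves t) \<Longrightarrow> h x = h' x) \<Longrightarrow> tree_eval m h t = tree_eval m h' t"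
  by (induction t) auto

lemma tree_eval_graft_at:
  "tree_eval m h (graft_at i t s) = tree_eval m
     (\<lambda>j. if j < i then h j else if j = i then tree_eval m (\<lambda>a. h (a + i - 1)) s
       else h (j + length (leaves s) - 1)) t"
  by (induction t) (auto simp: tree_eval_map)

lemma op_monomials_length: "t \<in> op_monomials n \<Longrightarrow> length (leaves t) = n"
  by (metis (mono_tags, lifting) op_monomials_def card_atLeastAtMost diff_Suc_1 distinct_card mem_Collect_eq)

lemma linear_vec_ext_comp:
  assumes "Vector_Spaces.linear s1 s2 L"
  shows "vec_ext s2 (\<lambda>x. L (h x)) f = L (vec_ext s1 h f)"
proof -
  interpret Vector_Spaces.linear s1 s2 L by fact
  show ?thesis by (simp add: vec_ext_def sum scale)
qed

context vector_space
begin

lemma vec_ext_lin_ext: "vec_ext scale h (lin_ext k f) = vec_ext scale (\<lambda>x. vec_ext scale h (k x)) f"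
  unfolding lin_ext_conv_vec_ext by (rule linear_vec_ext_comp[symmetric]) (rule linear_vec_ext)

lemma vec_ext_bilin_ext:
  "vec_ext scale h (bilin_ext p f g) = vec_ext scale (\<lambda>x. vec_ext scale (\<lambda>y. h (p x y)) g) f"
  by (simp add: bilin_ext_def vec_ext_lin_ext)

lemma vec_ext_swap:
  "vec_ext scale (\<lambda>x. vec_ext scale (H x) g) f = vec_ext scale (\<lambda>y. vec_ext scale (\<lambda>x. H x y) f) g"
  unfolding vec_ext_def scale_sum_right by (subst sum.swap) (simp add: mult.commute)

lemma vec_ext_eq_0:
  assumes "\<And>x. x \<in> Poly_Mapping.keys f \<Longrightarrow> h x = 0" shows "vec_ext scale h f = 0"
  unfolding vec_ext_def using assms by (intro sum.neutral) auto

lemma vec_ext_cong: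
  assumes "\<And>x. x \<in> Poly_Mapping.keys f \<Longrightarrow> h x = h' x"
  shows "vec_ext scale h f = vec_ext scale h' f"
  unfolding vec_ext_def using assms by (intro sum.cong) auto

end

context bilinear_ops
begin

lemma tree_eval_linear_in_leaf:
  assumes "distinct (leaves t)" "i \<in> set (leaves t)"
  shows "Vector_Spaces.linear scale scale (\<lambda>a. tree_eval opr (h(i := a)) t)"
  using assms
proof (induction t)
  case (Leaf x)
  then show ?case by (simp add: Vector_Spaces.linear_iff vector_space_axioms)
next
  case (Node p s t)
  show ?case
  proof (cases "i \<in> set (leaves s)")
    case True
    then have t: "tree_eval opr (h(i := a)) t = tree_eval opr h t" for a
      using Node.prems by (intro tree_eval_cong) auto
    have "Vector_Spaces.linear scale scale (\<lambda>a. tree_eval opr (h(i := a)) s)"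
      by (rule Node.IH(1)) (use Node.prems True in auto)
    then show ?thesis
      by (simp add: t Vector_Spaces.linear_iff opr_add_left opr_scale_left
          del: fun_upd_apply)
  next
    case False
    then have s: "tree_eval opr (h(i := a)) s = tree_eval opr h s" for a
      by (intro tree_eval_cong) auto
    have "Vector_Spaces.linear scale scale (\<lambda>a. tree_eval opr (h(i := a)) t)"
      by (rule Node.IH(2)) (use Node.prems False in auto)
    then show ?thesis
      by (simp add: s Vector_Spaces.linear_iff opr_add_right opr_scale_right
          del: fun_upd_apply)
  qed
qed

end

text \<open>
  Every \<open>\<B>\<G>\<^sup>!\<close>-algebra is an algebra over the operad. The induction is over the operations of the
  ideal with all possible arguments at once, since a composition \<open>f \<circ>\<^sub>i g\<close> with \<open>f\<close> in the ideal is evaluated by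
  substituting values of \<open>g\<close>; when \<open>g\<close> is in the ideal one uses instead that an operation
  depends linearly on its \<open>i\<close>-th argument.
\<close>

theorem (in bgdual_ops) op_ideal_vanishes:
  assumes "op_ideal n f"
  shows "vec_ext scale (tree_eval opr h) f = 0"
  using assms
proof (induction arbitrary: h rule: op_ideal.induct)
  case (relation f)
  have "vec_ext scale (tree_eval opr h) (op_left p q) = opr q (opr p (h 1) (h 2)) (h 3)"
    "vec_ext scale (tree_eval opr h) (op_right p q) = opr p (h 1) (opr q (h 2) (h 3))" for p q
    by (simp_all add: op_left_def op_right_def)
  with relation show ?case
    unfolding bgdual_relations_conv
    by (auto simp: vec_ext_diff opr_left_zero opr_right_zero dest: opr_assoc)
next
  case (zero n)
  then show ?case by simp
next
  case (add n f g)
  then show ?case by (simp add: vec_ext_add)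
next
  case (scale n f c)
  then show ?case by (simp add: vec_ext_scale)
next
  case (perm n f \<sigma>)
  then show ?case by (simp add: op_perm_def vec_ext_lin_ext tree_eval_map)
next
  case (comp_left m f g n i)
  show ?case
    unfolding op_comp_def vec_ext_bilin_ext
    by (subst vec_ext_swap) (simp add: tree_eval_graft_at comp_left.IH vec_ext_eq_0)
next
  case (comp_right f m n g i)
  \<comment> \<open>All trees in \<open>g\<close> have \<open>n\<close> leaves, so grafting them shifts the later leaves equally.\<close>
  define h1 where "h1 j = (if j < i then h j else h (j + n - 1))" for j
  define h2 where "h2 a = h (a + i - 1)" for a
  have "vec_ext scale (\<lambda>s. tree_eval opr h (graft_at i t s)) g = 0"
    if t: "t \<in> Poly_Mapping.keys f" for t
  proof -
    have t': "distinct (leaves t)" "i \<in> set (leaves t)"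
      using t comp_right.hyps(1,3) by (auto simp: free_op_iff op_monomials_def)
    have "vec_ext scale (\<lambda>s. tree_eval opr h (graft_at i t s)) g =
        vec_ext scale (\<lambda>s. tree_eval opr (h1(i := tree_eval opr h2 s)) t) g"
    proof (rule vec_ext_cong)
      fix s assume "s \<in> Poly_Mapping.keys g"
      then have "length (leaves s) = n"
        using op_ideal_free_op[OF comp_right.hyps(2)] by (auto simp: free_op_iff intro!: op_monomials_length)
      then show "tree_eval opr h (graft_at i t s) = tree_eval opr (h1(i := tree_eval opr h2 s)) t"
        unfolding tree_eval_graft_at by (intro tree_eval_cong) (auto simp: h1_def h2_def[abs_def])
    qed
    also have "\<dots> = tree_eval opr (h1(i := vec_ext scale (tree_eval opr h2) g)) t"
      by (rule linear_vec_ext_comp[OF tree_eval_linear_in_leaf[OF t']])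
    also have "\<dots> = tree_eval opr (h1(i := scale 0 0)) t" by (simp add: comp_right.IH)
    also have "\<dots> = 0"
      using tree_eval_linear_in_leaf[OF t', of h1] unfolding Vector_Spaces.linear_iff
      by (metis scale_zero_left)
    finally show ?thesis .
  qed
  then show ?case unfolding op_comp_def vec_ext_bilin_ext by (rule vec_ext_eq_0)
qed


section \<open>The operad as an algebra\<close>

text \<open>
  Composing a binary operation \<open>p\<close> with \<open>f\<close> and \<open>g\<close>, placed on disjoint consecutive sets of
  leaves, makes the sum of all components of the operad a \<open>\<B>\<G>\<^sup>!\<close>-algebra, to which the
  reduction to words applies.
\<close>

definition is_monomial :: "nat optree \<Rightarrow> bool" where
  "is_monomial t \<longleftrightarrow> (\<exists>n. t \<in> op_monomials n)"

definition juxtapose :: "bgop \<Rightarrow> nat optree \<Rightarrow> nat optree \<Rightarrow> nat optree" where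
  "juxtapose p s t = Node p s (map_optree (\<lambda>j. j + length (leaves s)) t)"

lemma leaves_not_Nil: "leaves t \<noteq> []"
  by (induction t) auto

lemma leaf_pos: "is_monomial t \<Longrightarrow> j \<in> set (leaves t) \<Longrightarrow> 1 \<le> j"
  by (auto simp: is_monomial_def op_monomials_def)

lemma graft_at_larger:
  "(\<And>j. j \<in> set (leaves t) \<Longrightarrow> i < j) \<Longrightarrow>
   graft_at i t s = map_optree (\<lambda>j. j + length (leaves s) - 1) t"
  by (induction t) (simp_all; force)+

lemma map_optree_cong:
  "(\<And>j. j \<in> set (leaves t) \<Longrightarrow> g j = h j) \<Longrightarrow> map_optree g t = map_optree h t"
  by (induction t) auto

lemma map_optree_comp: "map_optree g (map_optree h t) = map_optree (\<lambda>j. g (h j)) t"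
  by (induction t) auto

lemma map_optree_ident: "map_optree (\<lambda>j. j) t = t"
  by (induction t) auto

lemma graft_at_shifted:
  assumes "is_monomial t" "i \<le> k"
  shows "graft_at i (map_optree (\<lambda>j. j + k) t) s = map_optree (\<lambda>j. j + (k + length (leaves s) - 1)) t"
proof -
  have "graft_at i (map_optree (\<lambda>j. j + k) t) s =
      map_optree (\<lambda>j. j + length (leaves s) - 1) (map_optree (\<lambda>j. j + k) t)"
    using assms by (intro graft_at_larger) (auto simp: leaves_map_optree dest: leaf_pos)
  also have "\<dots> = map_optree (\<lambda>j. j + (k + length (leaves s) - 1)) t"
    unfolding map_optree_comp using leaves_not_Nil[of s]
    by (intro map_optree_cong) (cases "leaves s"; simp)
  finally show ?thesis .
qed

lemma juxtapose_graft:
  assumes "is_monomial t"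
  shows "graft_at 1 (graft_at 2 (Node p (Leaf 1) (Leaf 2)) t) s = juxtapose p s t"
proof -
  have "map_optree (\<lambda>a. a + 2 - 1) t = map_optree (\<lambda>j. j + 1) t"
    by (intro map_optree_cong) simp
  then show ?thesis
    using graft_at_shifted[OF assms, of 1 1 s]
    by (simp add: juxtapose_def map_optree_ident)
qed

text \<open>
  The rightmost leaf is replaced first, so that the leaves still to be replaced keep their numbers.
\<close>

lemma juxtapose_graft3:
  assumes "is_monomial t" "is_monomial u"
  shows "graft_at 1 (graft_at 2 (graft_at 3 (Node q (Node p (Leaf 1) (Leaf 2)) (Leaf 3)) u) t) s =
      juxtapose q (juxtapose p s t) u"
    and "graft_at 1 (graft_at 2 (graft_at 3 (Node p (Leaf 1) (Node q (Leaf 2) (Leaf 3))) u) t) s =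
      juxtapose p s (juxtapose q t u)"
proof -
  have 3: "map_optree (\<lambda>a. a + 3 - 1) u = map_optree (\<lambda>j. j + 2) u"
    "map_optree (\<lambda>a. a + 2 - 1) t = map_optree (\<lambda>j. j + 1) t"
    by (intro map_optree_cong; simp)+
  have u2: "graft_at 2 (map_optree (\<lambda>j. j + 2) u) t = map_optree (\<lambda>j. j + (length (leaves t) + 1)) u"
    using graft_at_shifted[OF assms(2), of 2 2 t] by (simp add: add.commute)
  have u1: "graft_at 1 (map_optree (\<lambda>j. j + (length (leaves t) + 1)) u) s =
      map_optree (\<lambda>j. j + (length (leaves s) + length (leaves t))) u"
    using graft_at_shifted[OF assms(2), of 1 "length (leaves t) + 1" s] by (simp add: add.commute)
  have t1: "graft_at 1 (map_optree (\<lambda>j. j + 1) t) s = map_optree (\<lambda>j. j + length (leaves s)) t"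
    using graft_at_shifted[OF assms(1), of 1 1 s] by simp
  have s1: "map_optree (\<lambda>a. a + 1 - 1) s = s" by (simp add: map_optree_ident)
  show "graft_at 1 (graft_at 2 (graft_at 3 (Node q (Node p (Leaf 1) (Leaf 2)) (Leaf 3)) u) t) s =
      juxtapose q (juxtapose p s t) u"
    using 3 u2 u1 t1 s1
    by (simp add: juxtapose_def leaves_map_optree)
  show "graft_at 1 (graft_at 2 (graft_at 3 (Node p (Leaf 1) (Node q (Leaf 2) (Leaf 3))) u) t) s =
      juxtapose p s (juxtapose q t u)"
    using 3 u2 u1 t1 s1
    by (simp add: juxtapose_def map_optree_comp add_ac)
qed

lemma Node_monomial: "Node p (Leaf 1) (Leaf 2) \<in> op_monomials 2"
  by (auto simp: op_monomials_def)

lemma juxtapose_monomial: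
  assumes "s \<in> op_monomials m" "t \<in> op_monomials n"
  shows "juxtapose p s t \<in> op_monomials (m + n)"
proof -
  have "graft_at 2 (Node p (Leaf 1) (Leaf 2)) t \<in> op_monomials (1 + n)"
    using graft_at_monomial[OF Node_monomial assms(2), of 2 p] by simp
  from graft_at_monomial[OF this assms(1), of 1]
  have "graft_at 1 (graft_at 2 (Node p (Leaf 1) (Leaf 2)) t) s \<in> op_monomials (m + n)"
    by (simp add: add.commute)
  then show ?thesis
    using assms(2) by (subst (asm) juxtapose_graft) (auto simp: is_monomial_def)
qed

lemma is_monomial_juxtapose: "is_monomial s \<Longrightarrow> is_monomial t \<Longrightarrow> is_monomial (juxtapose p s t)"
  unfolding is_monomial_def using juxtapose_monomial by blast

text \<open>
  The product \<open>(f, g) \<mapsto> (p \<circ>\<^sub>2 g) \<circ>\<^sub>1 f\<close>, extended by zero to the trees whose leaves are not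
  labelled by \<open>1, \<dots>, n\<close>. These are not operations, and the operadic ideal need not absorb
  their compositions.
\<close>

definition op_juxtapose ::
    "bgop \<Rightarrow> (nat optree \<Rightarrow>\<^sub>0 'k::field) \<Rightarrow> (nat optree \<Rightarrow>\<^sub>0 'k) \<Rightarrow> (nat optree \<Rightarrow>\<^sub>0 'k)" where
  "op_juxtapose p f g = lin_ext (\<lambda>s. lin_ext (\<lambda>t.
     if is_monomial s \<and> is_monomial t then basis_vec (juxtapose p s t) else 0) g) f"

lemma op_juxtapose_basis:
  "op_juxtapose p (basis_vec s) (basis_vec t) =
     (if is_monomial s \<and> is_monomial t then basis_vec (juxtapose p s t) else 0)"
  by (simp add: op_juxtapose_def)

lemma op_juxtapose_linear:
  "op_juxtapose p (f + f') g = op_juxtapose p f g + op_juxtapose p f' g"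
  "op_juxtapose p (pscale c f) g = pscale c (op_juxtapose p f g)"
  "op_juxtapose p (f - f') g = op_juxtapose p f g - op_juxtapose p f' g"
  "op_juxtapose p f (g + g') = op_juxtapose p f g + op_juxtapose p f g'"
  "op_juxtapose p f (pscale c g) = pscale c (op_juxtapose p f g)"
  "op_juxtapose p f (g - g') = op_juxtapose p f g - op_juxtapose p f g'"
  by (simp_all add: op_juxtapose_def lin_ext_add lin_ext_scale lin_ext_diff lin_ext_fun_add
      lin_ext_fun_scale lin_ext_fun_diff)

lemma op_ideal_sumI: "op_ideal n f \<Longrightarrow> f \<in> op_ideal_sum"
  unfolding op_ideal_sum_def by (intro pv.span_base) blast

lemma lin_ext_in_op_ideal_sum:
  "(\<And>x. x \<in> Poly_Mapping.keys f \<Longrightarrow> h x \<in> op_ideal_sum) \<Longrightarrow> lin_ext h f \<in> op_ideal_sum"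
  unfolding lin_ext_def op_ideal_sum_def by (intro pv.span_sum pv.span_scale)

lemma linear_op_juxtapose:
  "Vector_Spaces.linear pscale pscale (\<lambda>f. op_juxtapose p f g)"
  "Vector_Spaces.linear pscale pscale (op_juxtapose p f)"
  by (simp_all add: Vector_Spaces.linear_iff op_juxtapose_linear pv.vector_space_axioms)

lemma op_juxtapose_expand:
  "op_juxtapose p f g = lin_ext (\<lambda>s. op_juxtapose p (basis_vec s) g) f"
  "op_juxtapose p f g = lin_ext (\<lambda>t. op_juxtapose p f (basis_vec t)) g"
  by (rule linear_eq_on_basis[OF linear_op_juxtapose(1) linear_lin_ext], simp)
    (rule linear_eq_on_basis[OF linear_op_juxtapose(2) linear_lin_ext], simp)

lemma op_juxtapose_garbage:
  assumes "\<not> is_monomial t"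
  shows "op_juxtapose p f (basis_vec t) = 0" "op_juxtapose p (basis_vec t) f = 0"
  using assms by (simp_all add: op_juxtapose_def) (simp_all add: lin_ext_def)

lemma free_op_is_monomial: "f \<in> free_op n \<Longrightarrow> t \<in> Poly_Mapping.keys f \<Longrightarrow> is_monomial t"
  by (auto simp: free_op_iff is_monomial_def)

lemma op_juxtapose_comp:
  assumes "is_monomial t" "f \<in> free_op n"
  shows "op_juxtapose p f (basis_vec t) =
      op_comp 1 (op_comp 2 (basis_vec (Node p (Leaf 1) (Leaf 2))) (basis_vec t)) f"
    and "op_juxtapose p (basis_vec t) f =
      op_comp 1 (op_comp 2 (basis_vec (Node p (Leaf 1) (Leaf 2))) f) (basis_vec t)"
proof -
  have "op_juxtapose p f (basis_vec t) =
      lin_ext (\<lambda>s. basis_vec (graft_at 1 (graft_at 2 (Node p (Leaf 1) (Leaf 2)) t) s)) f"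
    unfolding op_juxtapose_def lin_ext_basis_vec juxtapose_graft[OF assms(1)]
    using assms by (intro lin_ext_cong) (simp add: free_op_is_monomial)
  then show "op_juxtapose p f (basis_vec t) =
      op_comp 1 (op_comp 2 (basis_vec (Node p (Leaf 1) (Leaf 2))) (basis_vec t)) f"
    unfolding op_comp_def bilin_ext_def lin_ext_basis_vec .
  have "op_juxtapose p (basis_vec t) f =
      lin_ext (\<lambda>s. basis_vec (graft_at 1 (graft_at 2 (Node p (Leaf 1) (Leaf 2)) s) t)) f"
    unfolding op_juxtapose_def lin_ext_basis_vec
  proof (intro lin_ext_cong)
    fix s assume "s \<in> Poly_Mapping.keys f"
    then have s: "is_monomial s" using assms(2) by (rule free_op_is_monomial[rotated])
    show "(if is_monomial t \<and> is_monomial s then basis_vec (juxtapose p t s) else 0) =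
        (basis_vec (graft_at 1 (graft_at 2 (Node p (Leaf 1) (Leaf 2)) s) t) :: nat optree \<Rightarrow>\<^sub>0 'a)"
      unfolding juxtapose_graft[OF s] using s assms(1) by simp
  qed
  also have "\<dots> = op_comp 1 (op_comp 2 (basis_vec (Node p (Leaf 1) (Leaf 2))) f) (basis_vec t)"
    unfolding op_comp_def bilin_ext_def lin_ext_basis_vec
    by (simp only: lin_ext_conv_vec_ext pv.vec_ext_lin_ext[unfolded lin_ext_conv_vec_ext]
        pv.vec_ext_basis_vec)
  finally show "op_juxtapose p (basis_vec t) f =
      op_comp 1 (op_comp 2 (basis_vec (Node p (Leaf 1) (Leaf 2))) f) (basis_vec t)" .
qed

lemma op_juxtapose_ideal:
  assumes f: "op_ideal m f"
  shows "op_juxtapose p f g \<in> op_ideal_sum" "op_juxtapose p g f \<in> op_ideal_sum"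
proof -
  have node: "basis_vec (Node p (Leaf 1) (Leaf 2)) \<in> free_op 2"
    using Node_monomial by simp
  have "op_juxtapose p f (basis_vec t) \<in> op_ideal_sum \<and> op_juxtapose p (basis_vec t) f \<in> op_ideal_sum" for t
  proof (cases "is_monomial t")
    case False
    then show ?thesis by (simp add: op_juxtapose_garbage op_ideal_sum_0)
  next
    case True
    then obtain n where t: "t \<in> op_monomials n" by (auto simp: is_monomial_def)
    have "op_comp 2 (basis_vec (Node p (Leaf 1) (Leaf 2))) (basis_vec t) \<in> (free_op (2 + n - 1) :: (nat optree \<Rightarrow>\<^sub>0 'a) set)"
      unfolding op_comp_def bilin_ext_basis_vec using graft_at_monomial[OF Node_monomial t, of 2 p]
      by (simp del: graft_at.simps)
    from op_ideal.comp_right[OF this f, of 1]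
    have "op_juxtapose p f (basis_vec t) \<in> op_ideal_sum"
      unfolding op_juxtapose_comp(1)[OF True op_ideal_free_op[OF f]]
      by (intro op_ideal_sumI) simp
    moreover have "op_ideal (2 + m - 1) (op_comp 2 (basis_vec (Node p (Leaf 1) (Leaf 2))) f)"
      by (rule op_ideal.comp_right[OF node f]) simp
    from op_ideal.comp_left[OF this, of "basis_vec t" n 1]
    have "op_juxtapose p (basis_vec t) f \<in> op_ideal_sum"
      unfolding op_juxtapose_comp(2)[OF True op_ideal_free_op[OF f]]
      using t by (intro op_ideal_sumI) simp
    ultimately show ?thesis ..
  qed
  then show "op_juxtapose p f g \<in> op_ideal_sum" "op_juxtapose p g f \<in> op_ideal_sum"
    using op_juxtapose_expand(2)[of p f g] op_juxtapose_expand(1)[of p g f]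
    by (simp_all add: lin_ext_in_op_ideal_sum)
qed

lemma op_juxtapose_ideal_sum:
  assumes "f \<in> op_ideal_sum"
  shows "op_juxtapose p f g \<in> op_ideal_sum" "op_juxtapose p g f \<in> op_ideal_sum"
proof -
  have "op_juxtapose p f g \<in> op_ideal_sum \<and> op_juxtapose p g f \<in> op_ideal_sum"
    using assms unfolding op_ideal_sum_def
  proof (induction rule: pv.span_induct_alt)
    case base
    show ?case using op_juxtapose_linear(2)[of p 0 0 g] op_juxtapose_linear(5)[of p g 0 0]
      by (simp add: pv.span_zero)
  next
    case (step c x y)
    then obtain m where "op_ideal m x" by auto
    from op_juxtapose_ideal[OF this, of p g] step(2) show ?case
      by (simp add: op_juxtapose_linear op_ideal_sum_def pv.span_add pv.span_scale)
  qed
  then show "op_juxtapose p f g \<in> op_ideal_sum" "op_juxtapose p g f \<in> op_ideal_sum" by auto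
qed

lift_definition bgdual_opr :: "bgop \<Rightarrow> 'k::field bgdual_op \<Rightarrow> 'k bgdual_op \<Rightarrow> 'k bgdual_op"
  is op_juxtapose
proof -
  fix p and f f' g g' :: "nat optree \<Rightarrow>\<^sub>0 'k"
  assume "f - f' \<in> op_ideal_sum" "g - g' \<in> op_ideal_sum"
  from op_ideal_sum_add[OF op_juxtapose_ideal_sum(1)[OF this(1), of p g]
      op_juxtapose_ideal_sum(2)[OF this(2), of p f']]
  show "op_juxtapose p f g - op_juxtapose p f' g' \<in> op_ideal_sum"
    by (simp add: op_juxtapose_linear)
qed

abbreviation tree_class :: "nat optree \<Rightarrow> 'k::field bgdual_op" where
  "tree_class t \<equiv> bgdual_class (basis_vec t)"

lemma linear_bgdual_class: "Vector_Spaces.linear pscale bgdual_scale bgdual_class"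
  by (simp add: Vector_Spaces.linear_iff plus_bgdual_op.abs_eq bgdual_scale.abs_eq
      pv.vector_space_axioms bgd.vector_space_axioms)

lemma surj_bgdual_class: "surj bgdual_class"
  by (rule surjI[of _ bgdual_rep]) (rule Quotient3_abs_rep[OF Quotient3_bgdual_op])

lemma span_tree_classes: "bgd.span (range tree_class) = (UNIV :: 'k::field bgdual_op set)"
proof -
  interpret c: Vector_Spaces.linear pscale bgdual_scale "bgdual_class :: _ \<Rightarrow> 'k bgdual_op"
    by (rule linear_bgdual_class)
  have "(UNIV :: 'k bgdual_op set) = bgdual_class ` pv.span (range basis_vec)"
    by (simp add: span_basis_vecs surj_bgdual_class)
  also have "\<dots> = bgd.span (bgdual_class ` range basis_vec)" by (rule c.span_image[symmetric])
  finally show ?thesis by (simp add: image_image)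
qed

lemma bgdual_opr_tree_class:
  "bgdual_opr p (tree_class s) (tree_class t) =
     (if is_monomial s \<and> is_monomial t then tree_class (juxtapose p s t) else 0)"
  by (simp add: bgdual_opr.abs_eq op_juxtapose_basis zero_bgdual_op.abs_eq)

lemma bilinear_bgdual_opr: "bilinear_ops bgdual_scale bgdual_opr"
proof (intro bilinear_ops.intro bilinear_ops_axioms.intro bgd.vector_space_axioms)
  note simps = bgdual_opr.abs_eq op_juxtapose_linear plus_bgdual_op.abs_eq bgdual_scale.abs_eq
  show "Vector_Spaces.linear bgdual_scale bgdual_scale (\<lambda>X. bgdual_opr p X Y)"
    for p and Y :: "'a bgdual_op"
  proof -
    have "bgdual_opr p (X + X') Y = bgdual_opr p X Y + bgdual_opr p X' Y"
      "bgdual_opr p (bgdual_scale c X) Y = bgdual_scale c (bgdual_opr p X Y)" for X X' c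
      by (induct X rule: bgdual_op.abs_induct; induct X' rule: bgdual_op.abs_induct;
          induct Y rule: bgdual_op.abs_induct; simp add: simps)+
    then show ?thesis by (simp add: Vector_Spaces.linear_iff bgd.vector_space_axioms)
  qed
  show "Vector_Spaces.linear bgdual_scale bgdual_scale (bgdual_opr p X)"
    for p and X :: "'a bgdual_op"
  proof -
    have "bgdual_opr p X (Y + Y') = bgdual_opr p X Y + bgdual_opr p X Y'"
      "bgdual_opr p X (bgdual_scale c Y) = bgdual_scale c (bgdual_opr p X Y)" for Y Y' c
      by (induct X rule: bgdual_op.abs_induct; induct Y rule: bgdual_op.abs_induct;
          induct Y' rule: bgdual_op.abs_induct; simp add: simps)+
    then show ?thesis by (simp add: Vector_Spaces.linear_iff bgd.vector_space_axioms)
  qed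
qed

lemma op_ideal_graft3:
  assumes f: "op_ideal 3 f" and "s \<in> op_monomials a" "t \<in> op_monomials b" "u \<in> op_monomials c"
  shows "op_comp 1 (op_comp 2 (op_comp 3 f (basis_vec u)) (basis_vec t)) (basis_vec s) \<in> op_ideal_sum"
proof -
  have "op_ideal (3 + c - 1) (op_comp 3 f (basis_vec u))"
    using assms by (intro op_ideal.comp_left) auto
  then have "op_ideal (3 + c - 1 + b - 1) (op_comp 2 (op_comp 3 f (basis_vec u)) (basis_vec t))"
    using assms by (intro op_ideal.comp_left) auto
  then have "op_ideal (3 + c - 1 + b - 1 + a - 1)
      (op_comp 1 (op_comp 2 (op_comp 3 f (basis_vec u)) (basis_vec t)) (basis_vec s))"
    using assms by (intro op_ideal.comp_left) auto
  then show ?thesis by (rule op_ideal_sumI)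
qed

lemma op_comp_diff_left: "op_comp i (f - f') g = op_comp i f g - op_comp i f' g"
  by (simp add: op_comp_def bilin_ext_diff_left)

lemma op_comp_graft3:
  assumes "is_monomial t" "is_monomial u"
  shows "op_comp 1 (op_comp 2 (op_comp 3 (op_left p q) (basis_vec u)) (basis_vec t)) (basis_vec s) =
      basis_vec (juxtapose q (juxtapose p s t) u)"
    and "op_comp 1 (op_comp 2 (op_comp 3 (op_right p q) (basis_vec u)) (basis_vec t)) (basis_vec s) =
      basis_vec (juxtapose p s (juxtapose q t u))"
  unfolding op_comp_def op_left_def op_right_def bilin_ext_basis_vec juxtapose_graft3[OF assms]
  by (rule refl)+

text \<open>
  The difference of the two sides of a relation at three monomials is obtained by grafting these
  onto a generator of the operadic ideal.
\<close>

lemma bgdual_opr_identities: "bgdual_identities bgdual_opr 0 (range tree_class)"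
proof -
  interpret bilinear_ops bgdual_scale "bgdual_opr :: bgop \<Rightarrow> 'a bgdual_op \<Rightarrow> _"
    by (rule bilinear_bgdual_opr)
  have "(\<forall>(p, q, r, s)\<in>assoc_ops. bgdual_opr q (bgdual_opr p x y) z = bgdual_opr r x (bgdual_opr s y z)) \<and>
     (\<forall>(p, q)\<in>left_zero_ops. bgdual_opr q (bgdual_opr p x y) z = 0) \<and>
     (\<forall>(p, q)\<in>right_zero_ops. bgdual_opr p x (bgdual_opr q y z) = 0)"
    if "x = tree_class s" "y = tree_class t" "z = tree_class u" for x y z :: "'a bgdual_op" and s t u
  proof (cases "is_monomial s \<and> is_monomial t \<and> is_monomial u")
    case False
    then show ?thesis by (auto simp: that bgdual_opr_tree_class)
  next
    case True
    then obtain a b c where mon: "s \<in> op_monomials a" "t \<in> op_monomials b" "u \<in> op_monomials c"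
      by (auto simp: is_monomial_def)
    have left: "bgdual_opr q (bgdual_opr p x y) z = tree_class (juxtapose q (juxtapose p s t) u)"
      and right: "bgdual_opr p x (bgdual_opr q y z) = tree_class (juxtapose p s (juxtapose q t u))" for p q
      using True by (simp_all add: that bgdual_opr_tree_class is_monomial_juxtapose)
    have ideal: "op_comp 1 (op_comp 2 (op_comp 3 f (basis_vec u)) (basis_vec t)) (basis_vec s) \<in> op_ideal_sum"
      if "f \<in> bgdual_relations" for f :: "nat optree \<Rightarrow>\<^sub>0 'a"
      using op_ideal_graft3[OF op_ideal.relation[OF that] mon] .
    have "tree_class (juxtapose q (juxtapose p s t) u) = (tree_class (juxtapose r s (juxtapose r' t u)) :: 'a bgdual_op)"
      if "(p, q, r, r') \<in> assoc_ops" for p q r r'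
    proof -
      have "op_left p q - op_right r r' \<in> (bgdual_relations :: (nat optree \<Rightarrow>\<^sub>0 'a) set)"
        using that unfolding bgdual_relations_conv by blast
      from ideal[OF this] show ?thesis
        using True by (simp only: op_comp_diff_left op_comp_graft3 bgdual_op.abs_eq_iff)
    qed
    moreover have "tree_class (juxtapose q (juxtapose p s t) u) = (0 :: 'a bgdual_op)"
      if "(p, q) \<in> left_zero_ops" for p q
    proof -
      have "op_left p q \<in> (bgdual_relations :: (nat optree \<Rightarrow>\<^sub>0 'a) set)"
        using that unfolding bgdual_relations_conv by blast
      from ideal[OF this] show ?thesis
        using True by (simp only: op_comp_graft3 bgdual_op.abs_eq_iff zero_bgdual_op.abs_eq diff_0_right)
    qed
    moreover have "tree_class (juxtapose p s (juxtapose q t u)) = (0 :: 'a bgdual_op)"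
      if "(p, q) \<in> right_zero_ops" for p q
    proof -
      have "op_right p q \<in> (bgdual_relations :: (nat optree \<Rightarrow>\<^sub>0 'a) set)"
        using that unfolding bgdual_relations_conv by blast
      from ideal[OF this] show ?thesis
        using True by (simp only: op_comp_graft3 bgdual_op.abs_eq_iff zero_bgdual_op.abs_eq diff_0_right)
    qed
    ultimately show ?thesis unfolding left right by blast
  qed
  note * = this
  show ?thesis
    unfolding bgdual_identities_def
  proof (intro ballI)
    fix x y z :: "'a bgdual_op"
    assume "x \<in> range tree_class" "y \<in> range tree_class" "z \<in> range tree_class"
    then obtain s t u where "x = tree_class s" "y = tree_class t" "z = tree_class u" by (elim rangeE)
    then show "(\<forall>(p, q, r, s)\<in>assoc_ops. bgdual_opr q (bgdual_opr p x y) z = bgdual_opr r x (bgdual_opr s y z)) \<and>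
      (\<forall>(p, q)\<in>left_zero_ops. bgdual_opr q (bgdual_opr p x y) z = 0) \<and>
      (\<forall>(p, q)\<in>right_zero_ops. bgdual_opr p x (bgdual_opr q y z) = 0)"
      by (rule *)
  qed
qed

interpretation bgd: bgdual_ops bgdual_scale bgdual_opr
proof -
  interpret bilinear_ops bgdual_scale "bgdual_opr :: bgop \<Rightarrow> 'a bgdual_op \<Rightarrow> _"
    by (rule bilinear_bgdual_opr)
  show "bgdual_ops bgdual_scale (bgdual_opr :: bgop \<Rightarrow> 'a bgdual_op \<Rightarrow> _)"
    by unfold_locales (rule identities_from_spanning[OF span_tree_classes bgdual_opr_identities])
qed


section \<open>Every operation is a combination of relabelled combs\<close>

text \<open>
  The same planar tree with its leaves numbered from left to right. It is the value of the tree
  in the algebra on the operad when all letters are the identity operation, see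
  \<open>tree_eval_bgdual_opr\<close>.
\<close>

fun standard_tree :: "'x optree \<Rightarrow> nat optree" where
  "standard_tree (Leaf x) = Leaf 1"
| "standard_tree (Node p s t) = juxtapose p (standard_tree s) (standard_tree t)"

lemma leaves_standard_tree: "leaves (standard_tree t) = [1..<Suc (length (leaves t))]"
proof (induction t)
  case (Node p s t)
  have "length (leaves (standard_tree s)) = length (leaves s)"
    using Node.IH(1) by (simp del: upt_Suc)
  then have "leaves (standard_tree (Node p s t)) =
      [1..<Suc (length (leaves s))] @ map (\<lambda>j. j + length (leaves s)) [1..<Suc (length (leaves t))]"
    using Node.IH by (simp add: juxtapose_def leaves_map_optree del: upt_Suc)
  also have "\<dots> = [1..<Suc (length (leaves s))] @ [Suc (length (leaves s))..<Suc (length (leaves s) + length (leaves t))]"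
    unfolding map_shift_upt by (simp add: add.commute del: upt_Suc)
  also have "\<dots> = [1..<Suc (length (leaves (Node p s t)))]"
    using upt_add_eq_append[of 1 "Suc (length (leaves s))" "length (leaves t)"] by simp
  finally show ?case .
qed auto

lemma op_monomial_of_leaves: "leaves t = [1..<Suc n] \<Longrightarrow> t \<in> op_monomials n"
  unfolding op_monomials_mset by simp

lemma standard_tree_monomial: "is_monomial (standard_tree t)"
  unfolding is_monomial_def by (rule exI, rule op_monomial_of_leaves, rule leaves_standard_tree)

lemma tree_eval_bgdual_opr: "tree_eval bgdual_opr (\<lambda>_. tree_class (Leaf 1)) t = tree_class (standard_tree t)"
  by (induction t) (simp_all add: bgdual_opr_tree_class standard_tree_monomial)

lemma optree_eqI:
  "map_optree (\<lambda>_. ()) s = map_optree (\<lambda>_. ()) t \<Longrightarrow> leaves s = leaves t \<Longrightarrow> s = t"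
proof (induction s arbitrary: t)
  case (Leaf x)
  then show ?case by (cases t) auto
next
  case (Node p s1 s2)
  obtain t1 t2 where t: "t = Node p t1 t2" using Node.prems(1) by (cases t) auto
  have shape: "map_optree (\<lambda>_. ()) s1 = map_optree (\<lambda>_. ()) t1"
    "map_optree (\<lambda>_. ()) s2 = map_optree (\<lambda>_. ()) t2"
    using Node.prems(1) by (auto simp: t)
  from arg_cong[OF shape(1), of "\<lambda>t. length (leaves t)"]
  have "length (leaves s1) = length (leaves t1)" by (simp add: leaves_map_optree)
  then show ?case using Node.prems(2) Node.IH(1)[OF shape(1)] Node.IH(2)[OF shape(2)] by (simp add: t)
qed

lemma shape_standard_tree: "map_optree (\<lambda>_. ()) (standard_tree t) = map_optree (\<lambda>_. ()) t"
  by (induction t) (simp_all add: juxtapose_def map_optree_comp)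

lemma relabel_standard_tree:
  assumes "map \<sigma> [1..<Suc (length (leaves t))] = leaves t"
  shows "map_optree \<sigma> (standard_tree t) = t"
proof (rule optree_eqI)
  have "map_optree (\<lambda>_. ()) (map_optree \<sigma> (standard_tree t)) = map_optree (\<lambda>_. ()) (standard_tree t)"
    by (simp add: map_optree_comp)
  then show "map_optree (\<lambda>_. ()) (map_optree \<sigma> (standard_tree t)) = map_optree (\<lambda>_. ()) t"
    by (simp add: shape_standard_tree)
  show "leaves (map_optree \<sigma> (standard_tree t)) = leaves t"
    unfolding leaves_map_optree leaves_standard_tree by (rule assms)
qed

lemma permutation_of_list:
  assumes "distinct xs" "set xs = {1..n}"
  obtains \<sigma> where "\<sigma> permutes {1..n}" "map \<sigma> [1..<Suc n] = xs"
proof -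
  have len: "length xs = n" using distinct_card[OF assms(1)] assms(2) by simp
  define \<sigma> where "\<sigma> i = (if i \<in> {1..n} then xs ! (i - 1) else i)" for i
  have map: "map \<sigma> [1..<Suc n] = xs"
    by (rule nth_equalityI) (auto simp: len \<sigma>_def simp del: upt_Suc)
  have "\<sigma> ` {1..n} = set (map \<sigma> [1..<Suc n])" by (simp add: atLeastLessThanSuc_atLeastAtMost del: upt_Suc)
  then have im: "\<sigma> ` {1..n} = {1..n}" unfolding map assms(2) .
  then have "inj_on \<sigma> {1..n}" by (intro eq_card_imp_inj_on) auto
  with im have "bij_betw \<sigma> {1..n} {1..n}" by (simp add: bij_betw_def)
  then have "\<sigma> permutes {1..n}" by (rule bij_imp_permutes) (auto simp: \<sigma>_def)
  with map show thesis by (rule that[rotated])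
qed

lemma bgdual_perm_tree_class:
  assumes "\<sigma> permutes {1..n}" "t \<in> op_monomials n"
  shows "bgdual_perm n \<sigma> (tree_class t) = tree_class (map_optree \<sigma> t)"
  using bgdual_perm_class[OF assms(1), of "basis_vec t"] assms(2) by (simp add: op_perm_def)

lemma bgdual_perm_0: "bgdual_perm n \<sigma> 0 = 0"
  by (simp add: zero_bgdual_op.abs_eq bgdual_perm.abs_eq arity_perm_def)

definition comb_class :: "nat nword option \<Rightarrow> 'k::field bgdual_op" where
  "comb_class X = (case X of None \<Rightarrow> 0 | Some T \<Rightarrow> tree_class (word_comb T))"

text \<open>
  The reduction to combs takes place in the algebra on the operad with the identity operation for
  every letter, where only trees numbered from left to right arise. It keeps the order of the leaves, as \<open>tree_word_letters\<close> says, so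
  one permutation relabels both the tree and its comb.
\<close>

lemma tree_class_conv_comb:
  assumes t: "t \<in> op_monomials n"
  shows "tree_class t = (comb_class (tree_word t) :: 'k::field bgdual_op)"
proof -
  have "distinct (leaves t)" "set (leaves t) = {1..n}" using t by (auto simp: op_monomials_def)
  then obtain \<sigma> where \<sigma>: "\<sigma> permutes {1..n}" "map \<sigma> [1..<Suc n] = leaves t"
    by (rule permutation_of_list)
  have perm: "tree_class s = (bgdual_perm n \<sigma> (tree_class (standard_tree s)) :: 'k bgdual_op)"
    if "leaves s = leaves t" for s :: "nat optree"
  proof -
    have len: "length (leaves s) = n" unfolding that by (rule op_monomials_length[OF t])
    have "standard_tree s \<in> op_monomials n"
      using leaves_standard_tree[of s] unfolding len by (rule op_monomial_of_leaves)
    moreover have "map_optree \<sigma> (standard_tree s) = s"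
      by (rule relabel_standard_tree) (simp only: len, simp only: \<sigma> that)
    ultimately show ?thesis using bgdual_perm_tree_class[OF \<sigma>(1)] by metis
  qed
  have std: "tree_class (standard_tree s) = (bgd.word_eval (\<lambda>_. tree_class (Leaf 1)) (tree_word s) :: 'k bgdual_op)"
    for s :: "nat optree"
    unfolding tree_eval_bgdual_opr[symmetric] by (rule bgd.tree_eval_word)
  show ?thesis
  proof (cases "tree_word t")
    case None
    then show ?thesis by (simp add: perm[OF refl] std comb_class_def bgdual_perm_0)
  next
    case (Some T)
    have "leaves (word_comb T) = leaves t"
      using tree_word_letters[OF Some] by (simp add: leaves_word_comb)
    from perm[OF this] perm[OF refl] show ?thesis
      by (simp add: std Some tree_word_comb comb_class_def)
  qed
qed


section \<open>The relabelled combs are linearly independent\<close>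

definition word_vec :: "'x nword option \<Rightarrow> ('x nword \<Rightarrow>\<^sub>0 'k::field)" where
  "word_vec X = (case X of None \<Rightarrow> 0 | Some T \<Rightarrow> basis_vec T)"

definition word_prod ::
    "bgop \<Rightarrow> ('x nword \<Rightarrow>\<^sub>0 'k::field) \<Rightarrow> ('x nword \<Rightarrow>\<^sub>0 'k) \<Rightarrow> ('x nword \<Rightarrow>\<^sub>0 'k)" where
  "word_prod p f g = lin_ext (\<lambda>S. lin_ext (\<lambda>T. word_vec (word_op p (Some S) (Some T))) g) f"

text \<open>The free algebra on the letters.\<close>

interpretation words: word_model pscale word_prod word_vec
proof (intro word_model.intro bilinear_ops.intro bilinear_ops_axioms.intro word_model_axioms.intro
    pv.vector_space_axioms)
  show "Vector_Spaces.linear pscale pscale (\<lambda>f. word_prod p f g)"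
    "Vector_Spaces.linear pscale pscale (word_prod p f)" for p and f g :: "'x nword \<Rightarrow>\<^sub>0 'k::field"
    by (simp_all add: Vector_Spaces.linear_iff pv.vector_space_axioms word_prod_def lin_ext_add
        lin_ext_scale lin_ext_fun_add lin_ext_fun_scale)
  show None: "word_vec None = 0" by (simp add: word_vec_def)
  show "word_prod p (word_vec X) (word_vec Y) = word_vec (word_op p X Y)" for p and X Y :: "'x nword option"
    by (cases X; cases Y) (simp_all add: word_prod_def word_vec_def lin_ext_def[of _ 0] lin_ext_def[of "\<lambda>_. 0"])
  have "range basis_vec \<subseteq> range (word_vec :: _ \<Rightarrow> 'x nword \<Rightarrow>\<^sub>0 'k::field)"
  proof
    fix v :: "'x nword \<Rightarrow>\<^sub>0 'k" assume "v \<in> range basis_vec"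
    then obtain T where "v = word_vec (Some T)" by (auto simp: word_vec_def)
    then show "v \<in> range word_vec" by blast
  qed
  from pv.span_mono[OF this]
  show "pv.span (range word_vec) = (UNIV :: ('x nword \<Rightarrow>\<^sub>0 'k::field) set)"
    by (simp add: span_basis_vecs top.extremum_unique)
qed

text \<open>
  The coordinates of an operation: its value at distinct letters in the algebra of words.
\<close>

lift_definition word_coords :: "'k::field bgdual_op \<Rightarrow> (nat nword \<Rightarrow>\<^sub>0 'k)"
  is "lin_ext (\<lambda>t. word_vec (tree_word t))"
proof -
  have val: "lin_ext (\<lambda>t. word_vec (tree_word t)) f = (0 :: nat nword \<Rightarrow>\<^sub>0 'k)" if "op_ideal n f" for n f
  proof -
    have "tree_eval word_prod (\<lambda>x. word_vec (letter x)) = (\<lambda>t. word_vec (tree_word t) :: nat nword \<Rightarrow>\<^sub>0 'k)"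
      by (rule ext) (rule words.tree_eval_model)
    with words.op_ideal_vanishes[OF that, of "\<lambda>x. word_vec (letter x)"] show ?thesis
      by (simp only: lin_ext_conv_vec_ext)
  qed
  have *: "lin_ext (\<lambda>t. word_vec (tree_word t)) f = (0 :: nat nword \<Rightarrow>\<^sub>0 'k)" if "f \<in> op_ideal_sum" for f
    using that unfolding op_ideal_sum_def
  proof (induction rule: pv.span_induct_alt)
    case (step c x y)
    then obtain n where "op_ideal n x" by auto
    from val[OF this] step(2) show ?case by (simp add: lin_ext_add lin_ext_scale)
  qed simp
  show "lin_ext (\<lambda>t. word_vec (tree_word t)) f = (lin_ext (\<lambda>t. word_vec (tree_word t)) g :: nat nword \<Rightarrow>\<^sub>0 'k)"
    if "f - g \<in> op_ideal_sum" for f g :: "nat optree \<Rightarrow>\<^sub>0 'k"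
    using *[OF that] by (simp only: lin_ext_diff right_minus_eq)
qed

lemma linear_word_coords: "Vector_Spaces.linear bgdual_scale pscale word_coords"
proof -
  have "word_coords (X + Y) = word_coords X + word_coords Y"
    "word_coords (bgdual_scale c X) = pscale c (word_coords X)" for X Y :: "'a bgdual_op" and c
    by (transfer, simp add: lin_ext_add lin_ext_scale)+
  then show ?thesis
    by (simp add: Vector_Spaces.linear_iff bgd.vector_space_axioms pv.vector_space_axioms)
qed

lemma word_coords_tree_class: "word_coords (tree_class t) = word_vec (tree_word t)"
  by (simp add: word_coords.abs_eq)

lemma word_coords_comb_class [simp]: "word_coords (comb_class (Some T)) = basis_vec T"
  by (simp add: comb_class_def word_coords_tree_class tree_word_comb word_vec_def)

definition multilinear_words :: "nat \<Rightarrow> nat nword set" where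
  "multilinear_words n = {T. distinct (letters T) \<and> set (letters T) = {1..n}}"

lemma tree_word_multilinear:
  "t \<in> op_monomials n \<Longrightarrow> tree_word t = Some T \<Longrightarrow> T \<in> multilinear_words n"
  using tree_word_letters[of t T] by (auto simp: multilinear_words_def op_monomials_def)

lemma word_comb_monomial: "T \<in> multilinear_words n \<Longrightarrow> word_comb T \<in> op_monomials n"
  by (simp add: multilinear_words_def op_monomials_def leaves_word_comb)

lemma comb_class_bgdual: "T \<in> multilinear_words n \<Longrightarrow> comb_class (Some T) \<in> bgdual n"
  unfolding bgdual_def comb_class_def option.case
  by (intro imageI) (simp add: word_comb_monomial)

text \<open>
  By \<open>tree_class_conv_comb\<close> the class of a tree is zero or the comb of its word; in the latter case
  this word is its only coordinate.
\<close>

lemma bgdual_expansion: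
  assumes "x \<in> bgdual n"
  shows "vec_ext bgdual_scale (\<lambda>T. comb_class (Some T)) (word_coords x) = x"
    and "Poly_Mapping.keys (word_coords x) \<subseteq> multilinear_words n"
proof -
  obtain f where f: "f \<in> free_op n" "x = bgdual_class f" using assms by (auto simp: bgdual_def)
  have cong: "word_coords (bgdual_class f) = lin_ext (\<lambda>t. word_vec (tree_word t)) f"
    by (simp add: word_coords.abs_eq)
  have "bgdual_class f = bgdual_class (vec_ext pscale basis_vec f)"
    by (simp add: basis_vec_expand flip: lin_ext_conv_vec_ext)
  also have "\<dots> = vec_ext bgdual_scale tree_class f"
    by (rule linear_vec_ext_comp[OF linear_bgdual_class, symmetric])
  also have "\<dots> = vec_ext bgdual_scale
      (\<lambda>t. vec_ext bgdual_scale (\<lambda>T. comb_class (Some T)) (word_vec (tree_word t))) f"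
  proof (rule bgd.vec_ext_cong)
    fix t assume "t \<in> Poly_Mapping.keys f"
    then have "t \<in> op_monomials n" using f(1) by (auto simp: free_op_iff)
    from tree_class_conv_comb[OF this]
    show "tree_class t = (vec_ext bgdual_scale (\<lambda>T. comb_class (Some T)) (word_vec (tree_word t)) :: 'a bgdual_op)"
      by (cases "tree_word t") (simp_all add: word_vec_def comb_class_def)
  qed
  also have "\<dots> = vec_ext bgdual_scale (\<lambda>T. comb_class (Some T)) (word_coords x)"
    unfolding f(2) cong bgd.vec_ext_lin_ext ..
  finally show "vec_ext bgdual_scale (\<lambda>T. comb_class (Some T)) (word_coords x) = x"
    using f(2) by simp
  show "Poly_Mapping.keys (word_coords x) \<subseteq> multilinear_words n"
    unfolding f(2) cong
  proof (rule keys_lin_ext)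
    fix t assume "t \<in> Poly_Mapping.keys f"
    then have "t \<in> op_monomials n" using f(1) by (auto simp: free_op_iff)
    then show "Poly_Mapping.keys (word_vec (tree_word t) :: nat nword \<Rightarrow>\<^sub>0 'a) \<subseteq> multilinear_words n"
      by (cases "tree_word t") (auto simp: word_vec_def tree_word_multilinear)
  qed
qed


section \<open>Counting the relabelled combs\<close>

text \<open>The word of the \<open>(l, k)\<close> comb, see \<open>left_comb_word\<close>.\<close>

definition standard_word :: "nat \<Rightarrow> nat \<times> nat \<Rightarrow> nat nword" where
  "standard_word n = (\<lambda>(l, k). NW [1..<l] l [Suc l..<Suc k] [Suc k..<Suc n])"

lemma foldl_constant_label:
  "(\<And>j. j \<in> set js \<Longrightarrow> c j = p) \<Longrightarrow> foldl (\<lambda>t j. Node (c j) t (Leaf j)) t js = attach p t js"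
  unfolding attach_def by (induction js arbitrary: t) auto

lemma upt_split: "a \<le> b \<Longrightarrow> b \<le> c \<Longrightarrow> [a..<c] = [a..<b] @ [b..<c]"
  by (metis le_add_diff_inverse upt_add_eq_append)

lemma left_comb_word:
  assumes "1 \<le> l" "l \<le> k" "k \<le> n"
  shows "left_comb n l k = word_comb (standard_word n (l, k))"
proof -
  let ?f = "foldl (\<lambda>t j. Node (comb_label l k j) t (Leaf j))"
  have tail: "?f t [Suc l..<Suc n] = attach Prec (attach Mul t [Suc l..<Suc k]) [Suc k..<Suc n]" for t
  proof -
    have "[Suc l..<Suc n] = [Suc l..<Suc k] @ [Suc k..<Suc n]"
      using assms by (intro upt_split) auto
    moreover have "?f t [Suc l..<Suc k] = attach Mul t [Suc l..<Suc k]" for t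
      by (rule foldl_constant_label) (auto simp: comb_label_def)
    moreover have "?f t [Suc k..<Suc n] = attach Prec t [Suc k..<Suc n]" for t
      using assms by (intro foldl_constant_label) (auto simp: comb_label_def)
    ultimately show ?thesis by (simp only: foldl_append)
  qed
  show ?thesis
  proof (cases "l = 1")
    case True
    then show ?thesis using tail[of "Leaf 1"]
      by (simp add: left_comb_def standard_word_def numeral_2_eq_2 del: upt_Suc)
  next
    case False
    with assms(1) have l: "2 \<le> l" by simp
    have "[2..<Suc n] = [2..<l] @ l # [Suc l..<Suc n]"
      using upt_split[of 2 l "Suc n"] upt_conv_Cons[of l "Suc n"] l assms by simp
    moreover have "?f (Leaf 1) [2..<l] = attach Mul (Leaf 1) [2..<l]"
      by (rule foldl_constant_label) (auto simp: comb_label_def)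
    moreover have "[1..<l] = 1 # [2..<l]"
      using upt_conv_Cons[of 1 l] l by (simp add: numeral_2_eq_2)
    ultimately show ?thesis
      using tail by (simp add: left_comb_def standard_word_def comb_label_def del: upt_Suc)
  qed
qed

lemma letters_standard_word:
  assumes "(l, k) \<in> comb_indices n" shows "letters (standard_word n (l, k)) = [1..<Suc n]"
proof -
  have lk: "1 \<le> l" "l \<le> k" "k \<le> n" using assms by (auto simp: comb_indices_def)
  have "[1..<Suc n] = [1..<l] @ [l..<Suc n]" using lk by (intro upt_split) auto
  also have "[l..<Suc n] = l # [Suc l..<Suc n]" using lk by (intro upt_conv_Cons) auto
  also have "[Suc l..<Suc n] = [Suc l..<Suc k] @ [Suc k..<Suc n]" using lk by (intro upt_split) auto
  finally show ?thesis by (simp add: standard_word_def del: upt_Suc)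
qed

lemma letters_map_nword: "letters (map_nword g T) = map g (letters T)"
  by (cases T) auto

lemma word_comb_map: "word_comb (map_nword g T) = map_optree g (word_comb T)"
proof -
  have attach: "attach p (map_optree g t) (map g xs) = map_optree g (attach p t xs)" for p t xs
    unfolding attach_def by (induction xs arbitrary: t) (auto simp flip: optree.map)
  show ?thesis by (cases T) (auto simp flip: attach split: list.splits)
qed

definition relabelled_word :: "nat \<Rightarrow> (nat \<times> nat) \<times> (nat \<Rightarrow> nat) \<Rightarrow> nat nword" where
  "relabelled_word n = (\<lambda>(j, \<sigma>). map_nword \<sigma> (standard_word n j))"

text \<open>
  A word whose letters are \<open>1, \<dots>, n\<close> in some order amounts to that order and to the two
  positions where its three blocks meet.
\<close>

lemma bij_betw_relabelled_word:
  "bij_betw (relabelled_word n) (comb_indices n \<times> {\<sigma>. \<sigma> permutes {1..n}}) (multilinear_words n)"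
proof (rule bij_betw_imageI)
  let ?A = "comb_indices n \<times> {\<sigma>. \<sigma> permutes {1..n}}"
  have letters: "letters (relabelled_word n ((l, k), \<sigma>)) = map \<sigma> [1..<Suc n]"
    if "(l, k) \<in> comb_indices n" for l k \<sigma>
    by (simp only: relabelled_word_def case_prod_conv letters_map_nword letters_standard_word[OF that])
  show "inj_on (relabelled_word n) ?A"
  proof (rule inj_onI)
    fix a b assume ab: "a \<in> ?A" "b \<in> ?A" "relabelled_word n a = relabelled_word n b"
    obtain l k \<sigma> l' k' \<sigma>' where ab_eq: "a = ((l, k), \<sigma>)" "b = ((l', k'), \<sigma>')"
      by (metis surj_pair)
    with ab have j: "(l, k) \<in> comb_indices n" "(l', k') \<in> comb_indices n"
      and \<sigma>: "\<sigma> permutes {1..n}" "\<sigma>' permutes {1..n}"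
      and eq: "relabelled_word n ((l, k), \<sigma>) = relabelled_word n ((l', k'), \<sigma>')"
      by auto
    from arg_cong[OF eq, of letters] have "map \<sigma> [1..<Suc n] = map \<sigma>' [1..<Suc n]"
      by (simp only: letters j)
    then have "\<sigma> i = \<sigma>' i" if "i \<in> {1..n}" for i
      using that by (auto simp del: upt_Suc)
    moreover have "\<sigma> i = \<sigma>' i" if "i \<notin> {1..n}" for i
      using \<sigma> that by (simp add: permutes_not_in)
    ultimately have "\<sigma> = \<sigma>'" by blast
    moreover have "length (map \<sigma> [1..<l]) = length (map \<sigma>' [1..<l'])"
      "length (map \<sigma> [Suc l..<Suc k]) = length (map \<sigma>' [Suc l'..<Suc k'])"
      using eq by (simp_all only: relabelled_word_def standard_word_def case_prod_conv nword.map nword.inject)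
    then have "l = l' \<and> k = k'" using j by (auto simp: comb_indices_def simp del: upt_Suc)
    ultimately show "a = b" by (simp add: ab_eq)
  qed
  show "relabelled_word n ` ?A = multilinear_words n"
  proof (intro equalityI subsetI)
    fix T assume "T \<in> relabelled_word n ` ?A"
    then obtain l k \<sigma> where T: "T = relabelled_word n ((l, k), \<sigma>)"
      and j: "(l, k) \<in> comb_indices n" and \<sigma>: "\<sigma> permutes {1..n}" by auto
    have "set [1..<Suc n] = {1..n}" by (simp only: set_upt atLeastLessThanSuc_atLeastAtMost)
    then show "T \<in> multilinear_words n"
      using permutes_inj_on[OF \<sigma>] permutes_image[OF \<sigma>]
      by (simp add: multilinear_words_def T letters[OF j] distinct_map del: upt_Suc)
  next
    fix T assume T: "T \<in> multilinear_words n"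
    obtain u x v w where NW: "T = NW u x v w" by (cases T)
    obtain \<sigma> where \<sigma>: "\<sigma> permutes {1..n}" "map \<sigma> [1..<Suc n] = letters T"
      using T permutation_of_list[of "letters T" n] by (auto simp: multilinear_words_def)
    define l k where "l = Suc (length u)" and "k = Suc (length u + length v)"
    have "length (letters T) = n" by (simp flip: \<sigma>(2) del: upt_Suc)
    then have j: "(l, k) \<in> comb_indices n" by (auto simp: comb_indices_def NW l_def k_def)
    have "map \<sigma> [1..<l] @ \<sigma> l # map \<sigma> [Suc l..<Suc k] @ map \<sigma> [Suc k..<Suc n] = u @ x # v @ w"
      using letters[OF j, of \<sigma>] unfolding \<sigma>(2)
      by (simp add: NW relabelled_word_def standard_word_def del: upt_Suc)
    moreover have "length (map \<sigma> [1..<l]) = length u" "length (map \<sigma> [Suc l..<Suc k]) = length v"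
      by (simp_all add: l_def k_def del: upt_Suc)
    ultimately have "T = relabelled_word n ((l, k), \<sigma>)"
      by (simp add: NW relabelled_word_def standard_word_def append_eq_append_conv del: upt_Suc)
    with j \<sigma>(1) show "T \<in> relabelled_word n ` ?A" by blast
  qed
qed

lemma finite_comb_indices: "finite (comb_indices n)"
  by (rule finite_subset[of _ "{1..n} \<times> {1..n}"]) (auto simp: comb_indices_def)

lemma card_comb_indices: "2 * card (comb_indices n) = n * (n + 1)"
proof (induction n)
  case 0
  have "comb_indices 0 = {}" by (auto simp: comb_indices_def)
  then show ?case by simp
next
  case (Suc n)
  have "comb_indices (Suc n) = comb_indices n \<union> (\<lambda>l. (l, Suc n)) ` {1..Suc n}"
    by (auto simp: comb_indices_def)
  moreover have "comb_indices n \<inter> (\<lambda>l. (l, Suc n)) ` {1..Suc n} = {}"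
    by (auto simp: comb_indices_def)
  moreover have "card ((\<lambda>l. (l, Suc n)) ` {1..Suc n}) = Suc n"
    by (subst card_image) (auto intro: inj_onI)
  ultimately have "card (comb_indices (Suc n)) = card (comb_indices n) + Suc n"
    by (simp add: card_Un_disjoint finite_comb_indices)
  then show ?case using Suc by simp
qed

lemma real_card_comb_indices: "real (card (comb_indices n)) = real n * (real n + 1) / 2"
proof -
  have "2 * real (card (comb_indices n)) = real n * (real n + 1)"
    using arg_cong[OF card_comb_indices[of n], of real] by (simp add: algebra_simps)
  then show ?thesis by simp
qed

lemma finite_multilinear_words: "finite (multilinear_words n)"
  using bij_betw_finite[OF bij_betw_relabelled_word] finite_comb_indices finite_permutations[of "{1..n}"]
  by blast

lemma card_multilinear_words: "card (multilinear_words n) = card (comb_indices n) * fact n"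
  using bij_betw_same_card[OF bij_betw_relabelled_word[of n]] card_permutations[of "{1..n}" n]
  by (simp add: card_cartesian_product)


section \<open>Dimension and free generation\<close>

abbreviation word_class :: "nat nword \<Rightarrow> 'k::field bgdual_op" where
  "word_class T \<equiv> comb_class (Some T)"

lemma bgdual_sum:
  assumes "x \<in> bgdual n"
  shows "x = (\<Sum>T\<in>multilinear_words n. bgdual_scale (Poly_Mapping.lookup (word_coords x) T) (word_class T))"
  using bgdual_expansion[OF assms] bgd.vec_ext_superset[OF finite_multilinear_words] by metis

lemma word_coords_sum:
  assumes "finite S" "T \<in> S"
  shows "Poly_Mapping.lookup (word_coords (\<Sum>T\<in>S. bgdual_scale (c T) (word_class T))) T = c T"
proof -
  interpret Vector_Spaces.linear bgdual_scale pscale "word_coords :: 'a bgdual_op \<Rightarrow> _"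
    by (rule linear_word_coords)
  have "Poly_Mapping.lookup (word_coords (\<Sum>T\<in>S. bgdual_scale (c T) (word_class T))) T =
      (\<Sum>U\<in>S. if U = T then c U else 0)"
    by (simp add: sum scale lookup_sum) (rule sum.cong; simp add: basis_vec_def lookup_single when_def)
  then show ?thesis using assms by simp
qed

lemma word_coords_0: "word_coords 0 = 0"
proof -
  interpret Vector_Spaces.linear bgdual_scale pscale "word_coords :: 'a bgdual_op \<Rightarrow> _"
    by (rule linear_word_coords)
  show "word_coords (0 :: 'a bgdual_op) = 0" by (rule zero)
qed

lemma inj_word_class: "inj word_class"
proof (rule injI)
  fix S T assume "word_class S = (word_class T :: 'a bgdual_op)"
  then have "basis_vec S = (basis_vec T :: nat nword \<Rightarrow>\<^sub>0 'a)"
    by (metis word_coords_comb_class)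
  then show "S = T" by (metis keys_basis_vec singleton_inject)
qed

lemma dim_bgdual: "bgd.dim (bgdual n :: 'k::field bgdual_op set) = card (multilinear_words n)"
proof -
  let ?B = "word_class ` multilinear_words n :: 'k bgdual_op set"
  have inj: "inj_on (word_class :: _ \<Rightarrow> 'k bgdual_op) (multilinear_words n)"
    by (rule inj_on_subset[OF inj_word_class]) simp
  have "?B \<subseteq> bgdual n" by (auto intro: comb_class_bgdual)
  moreover have "bgdual n \<subseteq> bgd.span ?B"
  proof
    fix x :: "'k bgdual_op" assume "x \<in> bgdual n"
    from bgdual_sum[OF this] show "x \<in> bgd.span ?B"
      by (metis (no_types, lifting) bgd.span_base bgd.span_scale bgd.span_sum imageI)
  qed
  moreover have "bgd.independent ?B"
    unfolding bgd.dependent_finite[OF finite_imageI[OF finite_multilinear_words]]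
  proof clarify
    fix c T assume T: "T \<in> multilinear_words n" and "c (word_class T) \<noteq> (0 :: 'k)"
      and 0: "(\<Sum>v\<in>?B. bgdual_scale (c v) v) = 0"
    have "(\<Sum>T\<in>multilinear_words n. bgdual_scale (c (word_class T)) (word_class T)) = 0"
      using 0 by (simp add: sum.reindex[OF inj])
    then have "c (word_class T) = 0"
      using word_coords_sum[OF finite_multilinear_words T, of "\<lambda>T. c (word_class T)"]
      by (simp add: word_coords_0)
    with \<open>c (word_class T) \<noteq> 0\<close> show False ..
  qed
  ultimately have "card ?B = bgd.dim (bgdual n :: 'k bgdual_op set)"
    by (rule bgd.basis_card_eq_dim)
  then show ?thesis by (simp add: card_image[OF inj])
qed

lemma standard_word_multilinear:
  assumes "j \<in> comb_indices n" shows "standard_word n j \<in> multilinear_words n"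
proof -
  obtain l k where j: "j = (l, k)" by (cases j)
  have "letters (standard_word n j) = [1..<Suc n]"
    using assms unfolding j by (rule letters_standard_word)
  moreover have "set [1..<Suc n] = {1..n}" by (simp only: set_upt atLeastLessThanSuc_atLeastAtMost)
  ultimately show ?thesis unfolding multilinear_words_def by (simp del: upt_Suc)
qed

lemma bgdual_comb_word:
  assumes "j \<in> comb_indices n" shows "bgdual_comb n j = word_class (standard_word n j)"
proof -
  obtain l k where j: "j = (l, k)" by (cases j)
  have "left_comb n l k = word_comb (standard_word n (l, k))"
    using assms by (intro left_comb_word) (auto simp: comb_indices_def j)
  then show ?thesis by (simp add: j bgdual_comb_def comb_class_def)
qed

text \<open>
  Permuting the leaves of the combs gives every multilinear word once, so the coordinates of
  an operation at these words are the coefficients of its expansion over the group algebra.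
\<close>

lemma group_algebra_act_comb:
  assumes "j \<in> comb_indices n"
  shows "group_algebra_act n \<alpha> (bgdual_comb n j) =
    (\<Sum>\<sigma> | \<sigma> permutes {1..n}. bgdual_scale (\<alpha> \<sigma>) (word_class (relabelled_word n (j, \<sigma>))))"
  unfolding group_algebra_act_def
proof (rule sum.cong)
  fix \<sigma> assume "\<sigma> \<in> {\<sigma>. \<sigma> permutes {1..n}}"
  then have \<sigma>: "\<sigma> permutes {1..n}" by simp
  have "bgdual_perm n \<sigma> (bgdual_comb n j) = (word_class (relabelled_word n (j, \<sigma>)) :: 'a bgdual_op)"
    using bgdual_perm_tree_class[OF \<sigma> word_comb_monomial[OF standard_word_multilinear[OF assms]]]
    by (simp add: bgdual_comb_word[OF assms] comb_class_def relabelled_word_def word_comb_map)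
  then show "bgdual_scale (\<alpha> \<sigma>) (bgdual_perm n \<sigma> (bgdual_comb n j)) =
      bgdual_scale (\<alpha> \<sigma>) (word_class (relabelled_word n (j, \<sigma>)))" by simp
qed simp

theorem combs_freely_generate:
  "freely_generates n (comb_indices n) (bgdual_comb n :: nat \<times> nat \<Rightarrow> 'k::field bgdual_op)"
proof -
  let ?J = "comb_indices n" and ?P = "{\<sigma>. \<sigma> permutes {1..n}}"
  let ?T = "relabelled_word n"
  have perm: "?T (j, \<sigma>) \<in> multilinear_words n" if "j \<in> ?J" "\<sigma> \<in> ?P" for j \<sigma>
    using bij_betwE[OF bij_betw_relabelled_word[of n]] that by auto
  have expand: "(\<Sum>j\<in>?J. group_algebra_act n (\<alpha> j) (bgdual_comb n j)) =
      (\<Sum>T\<in>multilinear_words n. bgdual_scale (c T) (word_class T) :: 'k bgdual_op)"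
    if c: "\<And>j \<sigma>. j \<in> ?J \<Longrightarrow> \<sigma> \<in> ?P \<Longrightarrow> c (?T (j, \<sigma>)) = \<alpha> j \<sigma>" for \<alpha> c
  proof -
    have "(\<Sum>T\<in>multilinear_words n. bgdual_scale (c T) (word_class T) :: 'k bgdual_op) =
        (\<Sum>i\<in>?J \<times> ?P. bgdual_scale (c (?T i)) (word_class (?T i)))"
      by (rule sum.reindex_bij_betw[OF bij_betw_relabelled_word, symmetric])
    also have "\<dots> = (\<Sum>j\<in>?J. \<Sum>\<sigma>\<in>?P. bgdual_scale (c (?T (j, \<sigma>))) (word_class (?T (j, \<sigma>))))"
      by (simp add: sum.cartesian_product)
    also have "\<dots> = (\<Sum>j\<in>?J. group_algebra_act n (\<alpha> j) (bgdual_comb n j))"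
      by (intro sum.cong refl) (simp add: group_algebra_act_comb c)
    finally show ?thesis by (rule sym)
  qed
  have "\<exists>!\<alpha>. \<alpha> \<in> ?J \<rightarrow>\<^sub>E group_algebra n \<and> x = (\<Sum>j\<in>?J. group_algebra_act n (\<alpha> j) (bgdual_comb n j))"
    if x: "x \<in> bgdual n" for x :: "'k bgdual_op"
  proof -
    define \<alpha> where "\<alpha> = (\<lambda>j\<in>?J. \<lambda>\<sigma>. if \<sigma> permutes {1..n} then Poly_Mapping.lookup (word_coords x) (?T (j, \<sigma>)) else 0)"
    show ?thesis
    proof (rule ex1I[of _ \<alpha>], intro conjI)
      show "\<alpha> \<in> ?J \<rightarrow>\<^sub>E group_algebra n" by (auto simp: \<alpha>_def group_algebra_def)
      have "(\<Sum>j\<in>?J. group_algebra_act n (\<alpha> j) (bgdual_comb n j)) =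
          (\<Sum>T\<in>multilinear_words n. bgdual_scale (Poly_Mapping.lookup (word_coords x) T) (word_class T))"
        by (rule expand) (simp add: \<alpha>_def)
      then show "x = (\<Sum>j\<in>?J. group_algebra_act n (\<alpha> j) (bgdual_comb n j))"
        using bgdual_sum[OF x] by simp
    next
      fix \<beta> assume "\<beta> \<in> ?J \<rightarrow>\<^sub>E group_algebra n \<and> x = (\<Sum>j\<in>?J. group_algebra_act n (\<beta> j) (bgdual_comb n j))"
      then have \<beta>: "\<beta> \<in> ?J \<rightarrow>\<^sub>E group_algebra n"
        and x_eq: "x = (\<Sum>j\<in>?J. group_algebra_act n (\<beta> j) (bgdual_comb n j))" by auto
      \<comment> \<open>The coefficients \<open>\<beta>\<close>, indexed by words, are the coordinates of \<open>x\<close>.\<close>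
      define c where "c T = (let (j, \<sigma>) = the_inv_into (?J \<times> ?P) ?T T in \<beta> j \<sigma>)" for T
      have c: "c (?T (j, \<sigma>)) = \<beta> j \<sigma>" if "j \<in> ?J" "\<sigma> \<in> ?P" for j \<sigma>
        using that the_inv_into_f_f[OF bij_betw_imp_inj_on[OF bij_betw_relabelled_word], of "(j, \<sigma>)" n]
        by (simp add: c_def)
      have "x = (\<Sum>T\<in>multilinear_words n. bgdual_scale (c T) (word_class T))"
        unfolding x_eq by (rule expand) (rule c)
      then have coords: "Poly_Mapping.lookup (word_coords x) (?T (j, \<sigma>)) = \<beta> j \<sigma>"
        if "j \<in> ?J" "\<sigma> \<in> ?P" for j \<sigma>
        using word_coords_sum[OF finite_multilinear_words perm[OF that], of c] c[OF that] by simp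
      show "\<beta> = \<alpha>"
      proof (rule PiE_ext[OF \<beta>])
        show "\<alpha> \<in> ?J \<rightarrow>\<^sub>E group_algebra n" by (auto simp: \<alpha>_def group_algebra_def)
        fix j assume "j \<in> ?J"
        then show "\<beta> j = \<alpha> j"
          using coords PiE_mem[OF \<beta>, of j] by (auto simp: \<alpha>_def group_algebra_def fun_eq_iff)
      qed
    qed
  qed
  moreover have "bgdual_comb n j \<in> (bgdual n :: 'k bgdual_op set)" if "j \<in> ?J" for j
    unfolding bgdual_comb_word[OF that] by (rule comb_class_bgdual[OF standard_word_multilinear[OF that]])
  ultimately show ?thesis unfolding freely_generates_def by blast
qed

theorem theorem47:
  shows "(bgdual_algebra (dfa_scale :: 'k::field \<Rightarrow> 'k dual_forest_alg \<Rightarrow> 'k dual_forest_alg)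
            dfa_mul dfa_succ dfa_prec \<and>
          (\<forall>(scale :: 'k \<Rightarrow> 'a::ab_group_add \<Rightarrow> 'a) mul succ prec a.
             bgdual_algebra scale mul succ prec \<longrightarrow>
             (\<exists>!\<phi>. bgdual_hom dfa_scale dfa_mul dfa_succ dfa_prec scale mul succ prec \<phi> \<and>
                   \<phi> dfa_bullet = a))) \<and>
         (\<forall>n\<ge>1. real (vector_space.dim bgdual_scale (bgdual n :: 'k bgdual_op set)) =
             real n * fact (n + 1) / 2) \<and>
         (\<forall>n\<ge>1. real (card (comb_indices n)) = real n * (real n + 1) / 2 \<and>
             freely_generates n (comb_indices n) (bgdual_comb n :: nat \<times> nat \<Rightarrow> 'k bgdual_op))"
proof (intro conjI allI impI)
  show "bgdual_algebra (dfa_scale :: 'k \<Rightarrow> 'k dual_forest_alg \<Rightarrow> 'k dual_forest_alg)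
            dfa_mul dfa_succ dfa_prec"
    by (rule bgdual_algebra_dfa)
next
  fix scale :: "'k \<Rightarrow> 'a \<Rightarrow> 'a" and mul succ prec a
  assume "bgdual_algebra scale mul succ prec"
  from dfa_free_hom[OF this, of a]
  show "\<exists>!\<phi>. bgdual_hom dfa_scale dfa_mul dfa_succ dfa_prec scale mul succ prec \<phi> \<and> \<phi> dfa_bullet = a"
    by (auto intro: dfa_hom_unique)
next
  fix n :: nat
  have "real (card (multilinear_words n)) = real n * (real n + 1) / 2 * fact n"
    by (simp add: card_multilinear_words real_card_comb_indices)
  then show "real (vector_space.dim bgdual_scale (bgdual n :: 'k bgdual_op set)) =
      real n * fact (n + 1) / 2"
    by (simp add: dim_bgdual algebra_simps)
next
  fix n :: nat
  show "real (card (comb_indices n)) = real n * (real n + 1) / 2" by (rule real_card_comb_indices)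
  show "freely_generates n (comb_indices n) (bgdual_comb n :: nat \<times> nat \<Rightarrow> 'k bgdual_op)"
    by (rule combs_freely_generate)
qed

end
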